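(* Fix $d\ge 3$, $c>0$, $\frac{d-1}{d+1}<\delta<1$ and an integer $k\ge 1$; let $p=(c+o_n(1))n^{-d+1+\delta}$ and $\mathcal{H}$ the random $d$-uniform hypergraph on $[n]$ with each $d$-subset a hyperedge independently with probability $p$. Then \[ \sup_{\substack{h_1,\dots,h_k\in\binom{[n]}{d}\\ \text{distinct}}}\ \sum_{G}\Pr[h_1,\dots,h_k\in E(\mathcal{H})\mid \mathrm{Proj}(\mathcal{H})=G]^2\,\Pr[\mathrm{Proj}(\mathcal{H})=G]=o_n(p^k), \] where the sum is over graphs $G$ with $\Pr[\mathrm{Proj}(\mathcal{H})=G]>0$.
   Context: $\mathrm{Proj}(H)$ is the graph on $[n]$ with $\{i,j\}$ an edge iff some hyperedge of $H$ contains $\{i,j\}$. *)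

theory Defs
  imports "HOL-Probability.Probability" "HOL-Library.Landau_Symbols" "HOL-Library.Ramsey"
begin

text \<open>
  The vertex set is always \<open>{1..n}\<close>, so a hypergraph or graph on it is represented by its
  set of (hyper)edges; isolated vertices are not lost.
\<close>

definition graphs_on :: "nat \<Rightarrow> nat set set set" where
  "graphs_on n = Pow (nsets {1..n} 2)"

definition Proj :: "nat \<Rightarrow> nat set set \<Rightarrow> nat set set" where
  "Proj n H = {{i, j} |i j. i \<in> {1..n} \<and> j \<in> {1..n} \<and> i \<noteq> j \<and> (\<exists>h\<in>H. {i, j} \<subseteq> h)}"

text \<open>
  The constant \<^const>\<open>bernoulli_pmf\<close> truncates its parameter to the unit interval. This affects
  no asymptotic statement about parameters \<open>p n\<close> that tend to \<open>0\<close> and are eventually positive.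
\<close>

definition random_hypergraph :: "nat \<Rightarrow> nat \<Rightarrow> real \<Rightarrow> nat set set pmf" where
  "random_hypergraph d n p =
     map_pmf (\<lambda>\<omega>. {h \<in> nsets {1..n} d. \<omega> h})
       (Pi_pmf (nsets {1..n} d) False (\<lambda>_. bernoulli_pmf p))"

end

theory Submission
  imports Defs "HOL-Real_Asymp.Real_Asymp"
begin

text \<open>
  Write \<open>X\<close> for the posterior probability of a fixed hyperedge \<open>h\<close> given the projection, and put
  \<open>q = n^(d-2) p\<close> (the order of the edge density of the projection), \<open>M = q^(d choose 2) / p\<close>
  (up to a constant, the ratio of spurious to genuine \<open>d\<close>-cliques). The hypothesis on \<open>\<delta>\<close> says exactly
  that \<open>M\<close> grows polynomially.

  The entropy of the hypergraph given its projection is at least its own entropy minus that of a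
  Bernoulli(\<open>q\<close>) graph, and at most the sum of the conditional entropies of the single hyperedges.
  All hyperedges are equivalent by symmetry, so \<open>E[X ln (1/X)] \<ge> p (ln M - O(1))\<close>. On the other
  hand \<open>X\<close> vanishes unless \<open>h\<close> spans a clique, which has probability \<open>O(q^(d choose 2)) = O(M p)\<close>.
  This forces \<open>E[X ln (1/X)] \<le> p (ln M + O(1)) - E[X^2] ln M / 2\<close>, and so
  \<open>E[X^2] = O(p / ln M) = o(p)\<close>.

  For \<open>k\<close> hyperedges \<open>h, a_2, \<dots>, a_k\<close>, planting \<open>A = {a_2, \<dots>, a_k}\<close> costs a factor \<open>p^(k-1)\<close>, and the
  projection of the planted hypergraph is a function of the projection of the unplanted one. So the
  second moment for \<open>k\<close> hyperedges reduces to the case \<open>k = 1\<close> by convexity of \<open>a^2 / b\<close>.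
\<close>

section \<open>Bernoulli random subsets\<close>

definition bernoulli_weight :: "real \<Rightarrow> 'a set \<Rightarrow> 'a set \<Rightarrow> real" where
  "bernoulli_weight p E H = p ^ card H * (1 - p) ^ card (E - H)"

text \<open>Events get their probability as a finite sum over subsets, which keeps all later
  estimates elementary; \<open>prob_random_hypergraph\<close> links this to the pmf.\<close>

definition subset_prob :: "real \<Rightarrow> 'a set \<Rightarrow> ('a set \<Rightarrow> bool) \<Rightarrow> real" where
  "subset_prob p E Q = (\<Sum>H | H \<subseteq> E \<and> Q H. bernoulli_weight p E H)"

text \<open>With \<open>a h + b h = 1\<close> this normalises product weights: the Bernoulli weight,
  and the product of posteriors in \<open>entropy_bound\<close>.\<close>

lemma sum_prod_Pow:
  fixes a b :: "'a \<Rightarrow> real"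
  assumes "finite E"
  shows "(\<Sum>H\<in>Pow E. \<Prod>h\<in>E. if h \<in> H then a h else b h) = (\<Prod>h\<in>E. a h + b h)"
proof -
  have "(\<Prod>h\<in>E. if h \<in> H then a h else b h) = prod a H * prod b (E - H)" if "H \<in> Pow E" for H
  proof -
    have "E = H \<union> (E - H)" using that by auto
    then have "(\<Prod>h\<in>E. if h \<in> H then a h else b h) = (\<Prod>h\<in>H \<union> (E - H). if h \<in> H then a h else b h)"
      by simp
    also have "\<dots> = prod a H * prod b (E - H)"
      by (subst prod.union_disjoint) (use that assms in \<open>auto intro: finite_subset\<close>)
    finally show ?thesis .
  qed
  then show ?thesis
    using prod_add[OF assms, of a b] by (simp add: algebra_simps)
qed

lemma bernoulli_weight_eq_prod:
  assumes "finite E" "H \<subseteq> E"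
  shows "bernoulli_weight p E H = (\<Prod>h\<in>E. if h \<in> H then p else 1 - p)"
proof -
  have "E = H \<union> (E - H)" using assms by auto
  then have "(\<Prod>h\<in>E. if h \<in> H then p else 1 - p) = (\<Prod>h\<in>H \<union> (E - H). if h \<in> H then p else 1 - p)"
    by simp
  also have "\<dots> = bernoulli_weight p E H"
    unfolding bernoulli_weight_def
    by (subst prod.union_disjoint) (use assms in \<open>auto intro: finite_subset\<close>)
  finally show ?thesis by simp
qed

lemma sum_bernoulli_weight: "finite E \<Longrightarrow> (\<Sum>H\<in>Pow E. bernoulli_weight p E H) = 1"
  by (subst sum.cong[OF refl bernoulli_weight_eq_prod]) (auto simp: sum_prod_Pow)

lemma bernoulli_weight_Un:
  assumes "finite E" "A \<subseteq> E" "H \<subseteq> E - A"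
  shows "bernoulli_weight p E (H \<union> A) = p ^ card A * bernoulli_weight p (E - A) H"
proof -
  have "card (H \<union> A) = card H + card A"
    by (rule card_Un_disjoint) (use assms in \<open>auto intro: finite_subset\<close>)
  moreover have "E - (H \<union> A) = E - A - H" by auto
  ultimately show ?thesis by (simp add: bernoulli_weight_def power_add)
qed

lemma bernoulli_weight_Diff:
  assumes "finite E" "A \<subseteq> E" "H \<subseteq> E - A"
  shows "bernoulli_weight p E H = (1 - p) ^ card A * bernoulli_weight p (E - A) H"
proof -
  have "card (E - H) = card ((E - A - H) \<union> A)"
    by (rule arg_cong[where f=card]) (use assms in auto)
  also have "\<dots> = card (E - A - H) + card A"
    by (rule card_Un_disjoint) (use assms in \<open>auto intro: finite_subset\<close>)
  finally show ?thesis by (simp add: bernoulli_weight_def power_add)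
qed

text \<open>Planting \<open>A\<close> leaves a Bernoulli subset of \<open>E - A\<close>, and so does
  forbidding \<open>A\<close> in \<open>subset_prob_disjoint\<close>. The two situations therefore
  differ only by the factor \<open>(p / (1 - p)) ^ card A\<close>.\<close>

lemma subset_prob_superset:
  assumes "finite E" "A \<subseteq> E"
  shows "subset_prob p E (\<lambda>H. A \<subseteq> H \<and> Q H)
    = p ^ card A * subset_prob p (E - A) (\<lambda>H. Q (H \<union> A))"
proof -
  have "bij_betw (\<lambda>H. H \<union> A) {H. H \<subseteq> E - A \<and> Q (H \<union> A)} {H. H \<subseteq> E \<and> A \<subseteq> H \<and> Q H}"
    by (rule bij_betwI[where g="\<lambda>H. H - A"]) (use assms in \<open>auto simp: Un_absorb2\<close>)
  from sum.reindex_bij_betw[OF this, of "bernoulli_weight p E"]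
  have "subset_prob p E (\<lambda>H. A \<subseteq> H \<and> Q H)
    = (\<Sum>H | H \<subseteq> E - A \<and> Q (H \<union> A). bernoulli_weight p E (H \<union> A))"
    by (simp add: subset_prob_def)
  also have "\<dots> = (\<Sum>H | H \<subseteq> E - A \<and> Q (H \<union> A). p ^ card A * bernoulli_weight p (E - A) H)"
    by (intro sum.cong refl bernoulli_weight_Un) (use assms in auto)
  finally show ?thesis by (simp add: subset_prob_def sum_distrib_left)
qed

lemma subset_prob_disjoint:
  assumes "finite E" "A \<subseteq> E"
  shows "subset_prob p E (\<lambda>H. A \<inter> H = {} \<and> Q H) = (1 - p) ^ card A * subset_prob p (E - A) Q"
proof -
  have eq: "{H. H \<subseteq> E \<and> A \<inter> H = {} \<and> Q H} = {H. H \<subseteq> E - A \<and> Q H}"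
    by auto
  show ?thesis
    unfolding subset_prob_def eq sum_distrib_left
    by (intro sum.cong refl bernoulli_weight_Diff) (use assms in auto)
qed

lemma subset_prob_True: "finite E \<Longrightarrow> subset_prob p E (\<lambda>_. True) = 1"
  by (simp add: subset_prob_def sum_bernoulli_weight flip: Pow_def)

lemma subset_prob_supset:
  assumes "finite E" "A \<subseteq> E"
  shows "subset_prob p E (\<lambda>H. A \<subseteq> H) = p ^ card A"
  using subset_prob_superset[OF assms, of p "\<lambda>_. True"] assms by (simp add: subset_prob_True)

lemma subset_prob_mono:
  assumes "finite E" "0 \<le> p" "p \<le> 1" "\<And>H. H \<subseteq> E \<Longrightarrow> Q H \<Longrightarrow> Q' H"
  shows "subset_prob p E Q \<le> subset_prob p E Q'"
  unfolding subset_prob_def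
  by (rule sum_mono2) (use assms in \<open>auto simp: bernoulli_weight_def\<close>)

lemma subset_prob_nonneg: "0 \<le> p \<Longrightarrow> p \<le> 1 \<Longrightarrow> 0 \<le> subset_prob p E Q"
  unfolding subset_prob_def by (intro sum_nonneg) (auto simp: bernoulli_weight_def)

lemma subset_prob_alt:
  "finite E \<Longrightarrow> subset_prob p E Q = (\<Sum>H\<in>Pow E. if Q H then bernoulli_weight p E H else 0)"
  by (simp add: subset_prob_def sum.If_cases Pow_def Int_def)

lemma subset_prob_union_bound:
  assumes "finite E" "0 \<le> p" "p \<le> 1" "finite I" "\<And>H. H \<subseteq> E \<Longrightarrow> Q H \<Longrightarrow> \<exists>i\<in>I. Q' i H"
  shows "subset_prob p E Q \<le> (\<Sum>i\<in>I. subset_prob p E (Q' i))"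
proof -
  have nn: "bernoulli_weight p E H \<ge> 0" for H
    using assms by (simp add: bernoulli_weight_def)
  have "(if Q H then bernoulli_weight p E H else 0)
      \<le> (\<Sum>i\<in>I. if Q' i H then bernoulli_weight p E H else 0)" if "H \<in> Pow E" for H
  proof (cases "Q H")
    case True
    then have "\<exists>i\<in>I. Q' i H" using assms(5)[of H] that by simp
    then obtain i where "i \<in> I" "Q' i H" by blast
    then show ?thesis
      using member_le_sum[of i I "\<lambda>i. if Q' i H then bernoulli_weight p E H else 0"] nn True assms(4)
      by auto
  qed (simp add: sum_nonneg nn)
  then show ?thesis
    unfolding subset_prob_alt[OF assms(1)] by (subst sum.swap) (rule sum_mono)
qed

lemma sum_card_bernoulli_weight:
  assumes "finite E"
  shows "(\<Sum>H\<in>Pow E. bernoulli_weight p E H * real (card H)) = real (card E) * p"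
proof -
  have "(\<Sum>H\<in>Pow E. bernoulli_weight p E H * real (card H))
      = (\<Sum>H\<in>Pow E. \<Sum>h\<in>E. if h \<in> H then bernoulli_weight p E H else 0)"
    by (intro sum.cong refl, subst sum.If_cases) (use assms in \<open>auto simp: Int_absorb1 Int_absorb2 Int_def[symmetric] mult.commute\<close>)
  also have "\<dots> = (\<Sum>h\<in>E. subset_prob p E (\<lambda>H. {h} \<subseteq> H))"
    by (subst sum.swap) (auto simp: subset_prob_def sum.If_cases assms Int_def intro!: sum.cong)
  also have "\<dots> = (\<Sum>h\<in>E. p)"
  proof (rule sum.cong[OF refl])
    fix h assume "h \<in> E"
    then show "subset_prob p E (\<lambda>H. {h} \<subseteq> H) = p"
      using subset_prob_supset[OF assms, of "{h}" p] by simp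
  qed
  also have "\<dots> = real (card E) * p" by simp
  finally show ?thesis .
qed

section \<open>Inequalities\<close>

text \<open>This is \<open>ln t \<le> t - 1\<close> at \<open>t = T x / P x\<close>, averaged over
  \<open>P\<close>. Only the total masses are compared, so \<open>T\<close> may be a subprobability
  weight.\<close>

lemma gibbs_inequality:
  fixes P T :: "'a \<Rightarrow> real"
  assumes "finite A" "\<And>x. x \<in> A \<Longrightarrow> P x > 0" "\<And>x. x \<in> A \<Longrightarrow> T x > 0" "sum T A \<le> sum P A"
  shows "(\<Sum>x\<in>A. P x * ln (T x)) \<le> (\<Sum>x\<in>A. P x * ln (P x))"
proof -
  have "P x * ln (T x) - P x * ln (P x) \<le> T x - P x" if "x \<in> A" for x
  proof -
    have "P x * ln (T x / P x) \<le> P x * (T x / P x - 1)"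
      using assms(2,3)[OF that] by (intro mult_left_mono ln_le_minus_one) auto
    then show ?thesis
      using assms(2,3)[OF that] by (simp add: ln_div algebra_simps)
  qed
  then have "(\<Sum>x\<in>A. P x * ln (T x) - P x * ln (P x)) \<le> (\<Sum>x\<in>A. T x - P x)"
    by (rule sum_mono)
  then show ?thesis using assms(4) by (simp add: sum_subtractf)
qed

text \<open>Cauchy-Schwarz for \<open>a / sqrt b\<close> and \<open>sqrt b\<close>. The assumption
  \<open>a x \<le> b x\<close> forces \<open>a x = 0\<close> wherever \<open>b x = 0\<close>, so the
  convention for division by zero loses nothing.\<close>

lemma sedrakyan_sum:
  fixes a b :: "'a \<Rightarrow> real"
  assumes "\<And>x. x \<in> A \<Longrightarrow> 0 \<le> a x" "\<And>x. x \<in> A \<Longrightarrow> a x \<le> b x"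
  shows "(sum a A)\<^sup>2 \<le> (\<Sum>x\<in>A. (a x)\<^sup>2 / b x) * sum b A"
proof -
  have b: "0 \<le> b x" if "x \<in> A" for x using assms[OF that] by linarith
  have "a x = a x / sqrt (b x) * sqrt (b x)" if "x \<in> A" for x
    using assms[OF that] by (cases "b x = 0") auto
  then have "sum a A = (\<Sum>x\<in>A. a x / sqrt (b x) * sqrt (b x))"
    by (intro sum.cong refl)
  also have "(\<dots>)\<^sup>2 \<le> (\<Sum>x\<in>A. (a x / sqrt (b x))\<^sup>2) * (\<Sum>x\<in>A. (sqrt (b x))\<^sup>2)"
    by (rule Cauchy_Schwarz_ineq_sum)
  also have "\<dots> = (\<Sum>x\<in>A. (a x)\<^sup>2 / b x) * sum b A"
    using b by (simp add: power_divide)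
  finally show ?thesis .
qed

text \<open>Split at \<open>1 / sqrt M\<close>. Below it, \<open>x * ln M \<le> 2\<close>, so the
  quadratic term is at most \<open>x\<close>, and \<open>ln t \<le> t - 1\<close> at
  \<open>t = 1 / (M * x)\<close> handles the entropy. Above it, \<open>- ln x\<close> is at most
  half of \<open>ln M\<close>, and the other half pays for the quadratic term.\<close>

lemma xlnx_bound:
  fixes x M :: real
  assumes "0 < x" "x \<le> 1" "1 \<le> M"
  shows "- (x * ln x) + x\<^sup>2 * ln M / 2 \<le> x * ln M + x + 1 / M"
proof (cases "x \<le> 1 / sqrt M")
  case True
  have "ln M = 2 * ln (sqrt M)" using assms by (simp add: ln_sqrt)
  also have "\<dots> \<le> 2 * sqrt M" using ln_le_minus_one[of "sqrt M"] assms by simp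
  finally have lnM: "ln M \<le> 2 * sqrt M" .
  have "x * ln M \<le> 1 / sqrt M * (2 * sqrt M)"
    using True lnM assms by (intro mult_mono) auto
  also have "\<dots> = 2" using assms by simp
  finally have "x * ln M \<le> 2" .
  then have 1: "x\<^sup>2 * ln M / 2 \<le> x"
    using mult_left_mono[of "x * ln M" 2 x] assms by (simp add: power2_eq_square)
  have "x * ln (1 / (M * x)) \<le> x * (1 / (M * x) - 1)"
    using assms by (intro mult_left_mono ln_le_minus_one) auto
  then have "- (x * ln x) \<le> x * ln M + 1 / M"
    using assms by (simp add: ln_div ln_mult algebra_simps)
  with 1 show ?thesis by simp
next
  case False
  then have "ln (1 / sqrt M) \<le> ln x"
    using assms by (intro iffD2[OF ln_le_cancel_iff]) auto
  then have "- ln x \<le> ln M / 2"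
    using assms by (simp add: ln_div ln_sqrt)
  then have 1: "- (x * ln x) \<le> x * ln M / 2"
    using mult_left_mono[of "- ln x" "ln M / 2" x] assms by simp
  have "x\<^sup>2 * ln M \<le> x * ln M"
    using assms by (intro mult_right_mono) (auto simp: power2_eq_square mult_le_one mult_left_le)
  moreover have "0 \<le> x" "0 \<le> 1 / M" using assms by auto
  ultimately show ?thesis using 1 by linarith
qed

text \<open>The absence of a hyperedge thus contributes at most its posterior \<open>x\<close> to
  the entropy, which averages to only \<open>p\<close>.\<close>

lemma neg_one_minus_xlnx:
  fixes x :: real
  assumes "0 \<le> x" "x \<le> 1"
  shows "- ((1 - x) * ln (1 - x)) \<le> x"
proof (cases "x = 1")
  case False
  have "(1 - x) * ln (1 / (1 - x)) \<le> (1 - x) * (1 / (1 - x) - 1)"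
    using assms False by (intro mult_left_mono ln_le_minus_one) auto
  then show ?thesis using assms False by (simp add: ln_div algebra_simps)
qed auto

section \<open>Posterior of a random subset given an observation\<close>

text \<open>The observation \<open>\<phi>\<close> stays abstract until it becomes
  \<open>Proj n\<close>. Strict bounds on \<open>p\<close> give every subset positive weight, so
  each attained observation has positive probability.\<close>

locale observed_subset =
  fixes p :: real and E :: "'a set" and \<phi> :: "'a set \<Rightarrow> 'b"
  assumes finite_E: "finite E" and p_pos: "0 < p" and p_less_1: "p < 1"
begin

abbreviation "wt \<equiv> bernoulli_weight p E"

abbreviation "Obs \<equiv> \<phi> ` Pow E"

definition joint :: "'a set \<Rightarrow> 'b \<Rightarrow> real" where
  "joint A G = subset_prob p E (\<lambda>H. A \<subseteq> H \<and> \<phi> H = G)"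

abbreviation "marg \<equiv> joint {}"

text \<open>The second moment of the posterior probability of \<open>A\<close>: each summand is the
  squared posterior \<open>joint A G / marg G\<close> weighted by \<open>marg G\<close>.\<close>

definition posterior_sq :: "'a set \<Rightarrow> real" where
  "posterior_sq A = (\<Sum>G\<in>Obs. (joint A G)\<^sup>2 / marg G)"

abbreviation "post h G \<equiv> joint {h} G / marg G"

lemma finite_Obs: "finite Obs"
  using finite_E by simp

lemma wt_pos: "wt H > 0"
  using p_pos p_less_1 by (simp add: bernoulli_weight_def)

lemma joint_nonneg: "0 \<le> joint A G"
  unfolding joint_def using p_pos p_less_1 by (intro subset_prob_nonneg) auto

lemma joint_antimono: "A \<subseteq> B \<Longrightarrow> joint B G \<le> joint A G"
  unfolding joint_def using p_pos p_less_1 finite_E by (intro subset_prob_mono) auto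

lemma joint_pos:
  assumes "A \<subseteq> H" "H \<subseteq> E" "\<phi> H = G"
  shows "0 < joint A G"
proof -
  have "0 < wt H" by (rule wt_pos)
  also have "\<dots> \<le> joint A G"
    unfolding joint_def subset_prob_def
    by (rule member_le_sum) (use assms finite_E wt_pos in \<open>auto simp: less_imp_le\<close>)
  finally show ?thesis .
qed

lemma marg_pos: "G \<in> Obs \<Longrightarrow> 0 < marg G"
  by (auto intro: joint_pos)

lemma post_bounds: "0 \<le> post h G" "post h G \<le> 1"
  using joint_nonneg[of "{}" G] joint_nonneg[of "{h}" G] joint_antimono[of "{}" "{h}" G]
  by (auto simp: divide_le_eq_1)

lemma sum_Pow_by_obs:
  "(\<Sum>H\<in>Pow E. f H) = (\<Sum>G\<in>Obs. \<Sum>H | H \<subseteq> E \<and> \<phi> H = G. f H)" for f :: "'a set \<Rightarrow> real"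
  using sum.image_gen[of "Pow E" f \<phi>] finite_E by (simp add: Pow_def)

lemma sum_joint: "A \<subseteq> E \<Longrightarrow> (\<Sum>G\<in>Obs. joint A G) = p ^ card A"
  using sum_Pow_by_obs[of "\<lambda>H. if A \<subseteq> H then wt H else 0"]
    subset_prob_supset[OF finite_E, of A p] finite_E
  by (simp add: joint_def subset_prob_alt[OF finite_E] sum.If_cases subset_prob_def)
     (simp add: Pow_def Int_def conj_ac cong: conj_cong)

text \<open>
  Gibbs' inequality against the weight \<open>T H\<close> that draws \<open>G\<close> from \<open>R\<close> and then the hyperedges
  independently with their posterior probabilities given \<open>G\<close>.
\<close>

lemma entropy_bound:
  assumes R_pos: "\<And>G. G \<in> Obs \<Longrightarrow> 0 < R G" and R_le: "(\<Sum>G\<in>Obs. R G) \<le> 1"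
  shows "(\<Sum>H\<in>Pow E. wt H * ln (R (\<phi> H)))
      + (\<Sum>h\<in>E. \<Sum>G\<in>Obs. marg G * (post h G * ln (post h G) + (1 - post h G) * ln (1 - post h G)))
    \<le> (\<Sum>H\<in>Pow E. wt H * ln (wt H))"
proof -
  define f where "f G H h = (if h \<in> H then post h G else 1 - post h G)" for G H h
  define T where "T H = R (\<phi> H) * (\<Prod>h\<in>E. f (\<phi> H) H h)" for H
  have f_nonneg: "0 \<le> f G H h" for G H h
    using post_bounds[of h G] by (simp add: f_def)
  have f_pos: "0 < f (\<phi> H) H h" if "H \<subseteq> E" "h \<in> E" for H h
  proof (cases "h \<in> H")
    case True
    then show ?thesis
      using joint_pos[of "{h}" H] joint_pos[of "{}" H] that by (simp add: f_def)
  next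
    case False
    \<comment> \<open>\<open>H\<close> lies in the fibre of its own observation and misses
      \<open>h\<close>, so the posterior of \<open>h\<close> there is strictly below 1.\<close>
    have "joint {h} (\<phi> H) + wt H \<le> marg (\<phi> H)"
    proof -
      have fin: "finite {H'. H' \<subseteq> E \<and> h \<in> H' \<and> \<phi> H' = \<phi> H}"
        by (rule finite_subset[of _ "Pow E"]) (use finite_E in auto)
      have "joint {h} (\<phi> H) + wt H = (\<Sum>H'\<in>insert H {H'. H' \<subseteq> E \<and> h \<in> H' \<and> \<phi> H' = \<phi> H}. wt H')"
        using False fin by (simp add: joint_def subset_prob_def)
      also have "\<dots> \<le> marg (\<phi> H)"
        unfolding joint_def subset_prob_def
        by (rule sum_mono2) (use that finite_E wt_pos in \<open>auto simp: less_imp_le\<close>)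
      finally show ?thesis .
    qed
    then have "joint {h} (\<phi> H) < marg (\<phi> H)" using wt_pos[of H] by linarith
    then show ?thesis
      using False joint_pos[of "{}" H "\<phi> H"] that by (simp add: f_def)
  qed
  have T_pos: "0 < T H" if "H \<in> Pow E" for H
    unfolding T_def using that by (intro mult_pos_pos R_pos prod_pos f_pos) auto
  \<comment> \<open>Once the inner sum runs over all subsets instead of one fibre, the product
    expands to a power of \<open>post + (1 - post) = 1\<close>. Hence \<open>T\<close> has mass at
    most that of \<open>R\<close>.\<close>
  have "sum T (Pow E) = (\<Sum>G\<in>Obs. \<Sum>H | H \<subseteq> E \<and> \<phi> H = G. R G * (\<Prod>h\<in>E. f G H h))"
    unfolding sum_Pow_by_obs by (intro sum.cong refl) (simp add: T_def)
  also have "\<dots> \<le> (\<Sum>G\<in>Obs. R G)"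
  proof (rule sum_mono)
    fix G assume G: "G \<in> Obs"
    have "(\<Sum>H | H \<subseteq> E \<and> \<phi> H = G. \<Prod>h\<in>E. f G H h) \<le> (\<Sum>H\<in>Pow E. \<Prod>h\<in>E. f G H h)"
      by (rule sum_mono2) (use finite_E in \<open>auto intro: prod_nonneg f_nonneg\<close>)
    also have "\<dots> = 1"
      unfolding f_def by (subst sum_prod_Pow) (auto simp: finite_E)
    finally show "(\<Sum>H | H \<subseteq> E \<and> \<phi> H = G. R G * (\<Prod>h\<in>E. f G H h)) \<le> R G"
      using R_pos[OF G] by (simp add: mult_left_le flip: sum_distrib_left)
  qed
  also have "\<dots> \<le> 1" by (rule R_le)
  also have "\<dots> = sum wt (Pow E)" using finite_E by (simp add: sum_bernoulli_weight)
  finally have "(\<Sum>H\<in>Pow E. wt H * ln (T H)) \<le> (\<Sum>H\<in>Pow E. wt H * ln (wt H))"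
    by (intro gibbs_inequality) (use finite_E wt_pos T_pos in auto)
  moreover have "(\<Sum>H\<in>Pow E. wt H * ln (T H))
      = (\<Sum>H\<in>Pow E. wt H * ln (R (\<phi> H))) + (\<Sum>H\<in>Pow E. \<Sum>h\<in>E. wt H * ln (f (\<phi> H) H h))"
  proof -
    have "ln (T H) = ln (R (\<phi> H)) + (\<Sum>h\<in>E. ln (f (\<phi> H) H h))" if "H \<in> Pow E" for H
    proof -
      have "0 < (\<Prod>h\<in>E. f (\<phi> H) H h)" using that f_pos by (intro prod_pos) auto
      moreover have "ln (\<Prod>h\<in>E. f (\<phi> H) H h) = (\<Sum>h\<in>E. ln (f (\<phi> H) H h))"
      proof (rule ln_prod)
        show "f (\<phi> H) H h \<noteq> 0" if "h \<in> E" for h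
          using f_pos[of H h] that \<open>H \<in> Pow E\<close> by simp
      qed (rule finite_E)
      moreover have "0 < R (\<phi> H)" using R_pos that by auto
      ultimately show ?thesis by (simp add: T_def ln_mult)
    qed
    then show ?thesis by (simp add: distrib_left sum.distrib sum_distrib_left)
  qed
  \<comment> \<open>On a fibre of \<open>\<phi>\<close> the logarithm takes just two values,
    according to whether \<open>h \<in> H\<close>; their total weights are
    \<open>joint {h} G\<close> and \<open>marg G - joint {h} G\<close>.\<close>
  moreover have "(\<Sum>H\<in>Pow E. wt H * ln (f (\<phi> H) H h))
      = (\<Sum>G\<in>Obs. marg G * (post h G * ln (post h G) + (1 - post h G) * ln (1 - post h G)))"
    for h
    unfolding sum_Pow_by_obs
  proof (rule sum.cong[OF refl])
    fix G assume G: "G \<in> Obs"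
    let ?S = "{H. H \<subseteq> E \<and> \<phi> H = G}"
    have fin: "finite ?S" by (rule finite_subset[of _ "Pow E"]) (use finite_E in auto)
    have in_h: "(\<Sum>H\<in>?S \<inter> {H. h \<in> H}. wt H) = joint {h} G"
      unfolding joint_def subset_prob_def by (rule sum.cong) auto
    have "marg G = (\<Sum>H\<in>?S. wt H)"
      unfolding joint_def subset_prob_def by (rule sum.cong) auto
    also have "\<dots> = (\<Sum>H\<in>?S \<inter> {H. h \<in> H}. wt H) + (\<Sum>H\<in>?S \<inter> - {H. h \<in> H}. wt H)"
      using fin by (subst sum.union_disjoint[symmetric]) (auto intro!: sum.cong)
    finally have not_h: "(\<Sum>H\<in>?S \<inter> - {H. h \<in> H}. wt H) = marg G - joint {h} G"
      using in_h by simp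
    have "(\<Sum>H\<in>?S. wt H * ln (f (\<phi> H) H h))
        = (\<Sum>H\<in>?S. if h \<in> H then wt H * ln (post h G) else wt H * ln (1 - post h G))"
      by (rule sum.cong) (auto simp: f_def)
    also have "\<dots> = joint {h} G * ln (post h G) + (marg G - joint {h} G) * ln (1 - post h G)"
      using fin by (simp add: sum.If_cases in_h not_h flip: sum_distrib_right)
    also have "\<dots> = marg G * (post h G * ln (post h G) + (1 - post h G) * ln (1 - post h G))"
      using marg_pos[OF G] by (simp add: field_simps)
    finally show "(\<Sum>H\<in>?S. wt H * ln (f (\<phi> H) H h)) = \<dots>" .
  qed
  moreover have "(\<Sum>H\<in>Pow E. \<Sum>h\<in>E. wt H * ln (f (\<phi> H) H h))
      = (\<Sum>h\<in>E. \<Sum>H\<in>Pow E. wt H * ln (f (\<phi> H) H h))"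
    by (rule sum.swap)
  ultimately show ?thesis by (simp only:)
qed

text \<open>\<open>xlnx_bound\<close> at the posterior \<open>X\<close> of \<open>h\<close>,
  averaged over observations. The error \<open>1 / M\<close> is charged only where \<open>Q\<close>
  holds, since elsewhere \<open>X = 0\<close>. The 2 collects one \<open>X\<close> from
  \<open>xlnx_bound\<close> and one from \<open>neg_one_minus_xlnx\<close>.\<close>

lemma posterior_sq_bound:
  assumes M: "1 \<le> M" and h: "h \<in> E"
    and Q: "\<And>H. H \<subseteq> E \<Longrightarrow> h \<in> H \<Longrightarrow> Q (\<phi> H)"
  shows "posterior_sq {h} * ln M / 2
    \<le> p * (ln M + 2) + subset_prob p E (\<lambda>H. Q (\<phi> H)) / M
      + (\<Sum>G\<in>Obs. marg G * (post h G * ln (post h G) + (1 - post h G) * ln (1 - post h G)))"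
proof -
  define q where "q G = (if Q G then marg G else 0)" for G
  have "(joint {h} G)\<^sup>2 / marg G * ln M / 2
      \<le> joint {h} G * (ln M + 2) + q G / M
        + marg G * (post h G * ln (post h G) + (1 - post h G) * ln (1 - post h G))"
    if G: "G \<in> Obs" for G
  proof -
    define X where "X = post h G"
    have X01: "0 \<le> X" "X \<le> 1" using post_bounds[of h G] by (auto simp: X_def)
    have J: "joint {h} G = marg G * X" using marg_pos[OF G] by (simp add: X_def)
    have q0: "0 \<le> q G" using marg_pos[OF G] by (simp add: q_def)
    have 1: "X\<^sup>2 * ln M / 2 - X * (ln M + 1) - X * ln X \<le> (if Q G then 1 / M else 0)"
    proof (cases "X = 0")
      case True
      then show ?thesis using M by simp
    next
      case False
      then have "joint {h} G \<noteq> 0" using J marg_pos[OF G] by simp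
      then obtain H where "H \<subseteq> E" "h \<in> H" "\<phi> H = G"
        unfolding joint_def subset_prob_def by (auto elim!: sum.not_neutral_contains_not_neutral)
      then have "Q G" using Q by auto
      then show ?thesis
        using xlnx_bound[of X M] X01 False M by (simp add: algebra_simps)
    qed
    have "X\<^sup>2 * ln M / 2
        \<le> X * (ln M + 2) + (if Q G then 1 / M else 0) + (X * ln X + (1 - X) * ln (1 - X))"
      using 1 neg_one_minus_xlnx[OF X01] by (simp add: algebra_simps)
    then have "marg G * (X\<^sup>2 * ln M / 2)
        \<le> marg G * (X * (ln M + 2) + (if Q G then 1 / M else 0) + (X * ln X + (1 - X) * ln (1 - X)))"
      using marg_pos[OF G] by (intro mult_left_mono) auto
    moreover have "(joint {h} G)\<^sup>2 / marg G = marg G * X\<^sup>2"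
      using marg_pos[OF G] by (simp add: J power2_eq_square)
    moreover have "marg G * (if Q G then 1 / M else 0) = q G / M" by (simp add: q_def)
    ultimately show ?thesis
      using marg_pos[OF G] unfolding X_def[symmetric] J by (simp add: algebra_simps)
  qed
  then have "(\<Sum>G\<in>Obs. (joint {h} G)\<^sup>2 / marg G * ln M / 2)
      \<le> (\<Sum>G\<in>Obs. joint {h} G * (ln M + 2) + q G / M
        + marg G * (post h G * ln (post h G) + (1 - post h G) * ln (1 - post h G)))"
    by (rule sum_mono)
  moreover have "(\<Sum>G\<in>Obs. q G) = subset_prob p E (\<lambda>H. Q (\<phi> H))"
    unfolding q_def subset_prob_alt[OF finite_E] sum_Pow_by_obs
    by (intro sum.cong refl) (auto simp: joint_def subset_prob_def)
  moreover have "(\<Sum>G\<in>Obs. joint {h} G) = p" using sum_joint[of "{h}"] h by simp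
  moreover have "(\<Sum>G\<in>Obs. (joint {h} G)\<^sup>2 / marg G * ln M / 2) = posterior_sq {h} * ln M / 2"
    by (simp only: posterior_sq_def sum_distrib_right sum_divide_distrib)
  ultimately show ?thesis
    by (simp only: sum.distrib sum_distrib_right[symmetric] sum_divide_distrib[symmetric])
qed

text \<open>Bernoulli weights depend only on cardinalities, so a permutation of \<open>E\<close>
  that acts on observations through \<open>\<Psi>\<close> merely relabels the sum.\<close>

lemma posterior_sq_image:
  assumes \<sigma>: "bij_betw \<sigma> E E" and h: "h \<in> E" and \<Psi>: "inj_on \<Psi> Obs"
    and equiv: "\<And>H. H \<subseteq> E \<Longrightarrow> \<phi> (\<sigma> ` H) = \<Psi> (\<phi> H)"
  shows "posterior_sq {\<sigma> h} = posterior_sq {h}"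
proof -
  have inj: "inj_on \<sigma> E" and im: "\<sigma> ` E = E"
    using \<sigma> by (auto simp: bij_betw_def)
  have Pow: "bij_betw (image \<sigma>) (Pow E) (Pow E)"
    using bij_betw_Pow[OF \<sigma>] .
  have sub: "\<sigma> ` H \<subseteq> E" if "H \<subseteq> E" for H
    using that im by blast
  have wt: "wt (\<sigma> ` H) = wt H" if "H \<subseteq> E" for H
  proof -
    have "E - \<sigma> ` H = \<sigma> ` (E - H)"
      using inj_on_image_set_diff[OF inj, of E H] that im by auto
    moreover have "card (\<sigma> ` H) = card H" "card (\<sigma> ` (E - H)) = card (E - H)"
      using that by (auto intro!: card_image inj_on_subset[OF inj])
    ultimately show ?thesis by (simp add: bernoulli_weight_def)
  qed
  have joint: "joint (\<sigma> ` A) (\<Psi> G) = joint A G" if A: "A \<subseteq> E" and G: "G \<in> Obs" for A G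
  proof -
    have iff: "(\<sigma> ` A \<subseteq> \<sigma> ` H \<and> \<phi> (\<sigma> ` H) = \<Psi> G) \<longleftrightarrow> (A \<subseteq> H \<and> \<phi> H = G)" if "H \<subseteq> E" for H
      using inj_on_image_subset_iff[OF inj A that] equiv[OF that] inj_onD[OF \<Psi>, of "\<phi> H" G] G that
      by auto
    have "joint (\<sigma> ` A) (\<Psi> G)
        = (\<Sum>H\<in>Pow E. if \<sigma> ` A \<subseteq> \<sigma> ` H \<and> \<phi> (\<sigma> ` H) = \<Psi> G then wt (\<sigma> ` H) else 0)"
      unfolding joint_def subset_prob_alt[OF finite_E]
      by (rule sum.reindex_bij_betw[OF Pow, symmetric])
    also have "\<dots> = joint A G"
      unfolding joint_def subset_prob_alt[OF finite_E]
      by (intro sum.cong refl) (use iff wt in auto)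
    finally show ?thesis .
  qed
  \<comment> \<open>Surjectivity of \<open>\<Psi>\<close> on observations comes from
    \<open>\<sigma>\<close> permuting the subsets of \<open>E\<close>.\<close>
  have "\<Psi> ` Obs = \<phi> ` (image \<sigma> ` Pow E)"
    by (auto simp: image_image equiv intro!: image_eqI)
  also have "\<dots> = Obs" using Pow by (simp add: bij_betw_def)
  finally have bij: "bij_betw \<Psi> Obs Obs" using \<Psi> by (simp add: bij_betw_def)
  have "posterior_sq {\<sigma> h} = (\<Sum>G\<in>Obs. (joint {\<sigma> h} (\<Psi> G))\<^sup>2 / marg (\<Psi> G))"
    unfolding posterior_sq_def by (rule sum.reindex_bij_betw[OF bij, symmetric])
  also have "\<dots> = posterior_sq {h}"
    unfolding posterior_sq_def
    by (intro sum.cong refl) (use joint[of "{h}"] joint[of "{}"] h in auto)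
  finally show ?thesis .
qed

text \<open>
  Apart from convexity, the point is that forbidding \<open>A\<close> (passing from \<open>marg\<close> to \<open>\<beta>\<close>) is harmless:
  observations that make \<open>A \<inter> H \<noteq> {}\<close> likely are paid for by the posteriors of the \<open>a \<in> A\<close>.
\<close>

lemma posterior_sq_insert_le:
  assumes A: "A \<subseteq> E" and h: "h \<in> E" "h \<notin> A"
    and \<psi>: "\<And>H. H \<subseteq> E \<Longrightarrow> \<phi> (H \<union> A) = \<psi> (\<phi> H)"
    and s: "\<And>h. h \<in> E \<Longrightarrow> posterior_sq {h} \<le> s"
  shows "posterior_sq (insert h A) \<le> (p / (1 - p)) ^ card A * (2 * real (Suc (card A)) * s)"
proof -
  \<comment> \<open>The likelihood ratio between planting \<open>A\<close> and forbidding
    it.\<close>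
  define r where "r = (p / (1 - p)) ^ card A"
  have r_pos: "0 < r" using p_pos p_less_1 by (simp add: r_def)
  have finA: "finite A" using A finite_E by (rule finite_subset)
  define \<alpha> where "\<alpha> G = subset_prob p E (\<lambda>H. A \<inter> H = {} \<and> h \<in> H \<and> \<phi> H = G)" for G
  define \<beta> where "\<beta> G = subset_prob p E (\<lambda>H. A \<inter> H = {} \<and> \<phi> H = G)" for G
  have \<alpha>_nonneg: "0 \<le> \<alpha> G" and \<beta>_nonneg: "0 \<le> \<beta> G" for G
    unfolding \<alpha>_def \<beta>_def using p_pos p_less_1 by (auto intro: subset_prob_nonneg)
  have \<alpha>_le_\<beta>: "\<alpha> G \<le> \<beta> G" and \<alpha>_le_joint: "\<alpha> G \<le> joint {h} G" and \<beta>_le_marg: "\<beta> G \<le> marg G" for G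
    unfolding \<alpha>_def \<beta>_def joint_def using p_pos p_less_1 finite_E by (auto intro!: subset_prob_mono)
  \<comment> \<open>Adding \<open>A\<close> to a set that avoids it multiplies the weight by
    \<open>r\<close> and changes the observation from \<open>G'\<close> to \<open>\<psi> G'\<close>;
    all \<open>G'\<close> in one fibre of \<open>\<psi>\<close> are merged.\<close>
  have split: "subset_prob p E (\<lambda>H. A \<subseteq> H \<and> Q (H - A) \<and> \<phi> H = G)
      = r * (\<Sum>G'\<in>{G'\<in>Obs. \<psi> G' = G}. subset_prob p E (\<lambda>H. A \<inter> H = {} \<and> Q H \<and> \<phi> H = G'))"
    for Q G
  proof -
    have "subset_prob p E (\<lambda>H. A \<subseteq> H \<and> Q (H - A) \<and> \<phi> H = G)
        = p ^ card A * subset_prob p (E - A) (\<lambda>H. Q (H \<union> A - A) \<and> \<phi> (H \<union> A) = G)"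
      by (rule subset_prob_superset[OF finite_E A])
    also have "subset_prob p (E - A) (\<lambda>H. Q (H \<union> A - A) \<and> \<phi> (H \<union> A) = G)
        = subset_prob p (E - A) (\<lambda>H. Q H \<and> \<psi> (\<phi> H) = G)"
      unfolding subset_prob_def
    proof (intro sum.cong refl Collect_cong conj_cong)
      fix H assume "H \<subseteq> E - A"
      then have "H \<union> A - A = H" "\<phi> (H \<union> A) = \<psi> (\<phi> H)" using \<psi>[of H] by auto
      then show "Q (H \<union> A - A) = Q H" "(\<phi> (H \<union> A) = G) = (\<psi> (\<phi> H) = G)" by auto
    qed
    also have "p ^ card A * \<dots> = r * ((1 - p) ^ card A * \<dots>)"
      using p_less_1 by (simp add: r_def power_divide)
    also have "(1 - p) ^ card A * subset_prob p (E - A) (\<lambda>H. Q H \<and> \<psi> (\<phi> H) = G)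
        = subset_prob p E (\<lambda>H. A \<inter> H = {} \<and> Q H \<and> \<psi> (\<phi> H) = G)"
      by (rule subset_prob_disjoint[OF finite_E A, symmetric])
    also have "\<dots> = (\<Sum>G'\<in>Obs. \<Sum>H | H \<subseteq> E \<and> \<phi> H = G'.
        if A \<inter> H = {} \<and> Q H \<and> \<psi> (\<phi> H) = G then wt H else 0)"
      unfolding subset_prob_alt[OF finite_E] sum_Pow_by_obs ..
    also have "\<dots> = (\<Sum>G'\<in>Obs. if \<psi> G' = G
        then subset_prob p E (\<lambda>H. A \<inter> H = {} \<and> Q H \<and> \<phi> H = G') else 0)"
    proof (intro sum.cong refl)
      fix G'
      have "finite {H. H \<subseteq> E \<and> \<phi> H = G'}" using finite_E by simp
      then show "(\<Sum>H | H \<subseteq> E \<and> \<phi> H = G'. if A \<inter> H = {} \<and> Q H \<and> \<psi> (\<phi> H) = G then wt H else 0)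
        = (if \<psi> G' = G then subset_prob p E (\<lambda>H. A \<inter> H = {} \<and> Q H \<and> \<phi> H = G') else 0)"
        by (auto simp: subset_prob_def sum.If_cases intro!: sum.cong)
    qed
    also have "\<dots> = (\<Sum>G'\<in>{G'\<in>Obs. \<psi> G' = G}. subset_prob p E (\<lambda>H. A \<inter> H = {} \<and> Q H \<and> \<phi> H = G'))"
      by (rule sum.inter_filter[symmetric]) (rule finite_Obs)
    finally show ?thesis .
  qed
  have joint_eq: "joint (insert h A) G = r * (\<Sum>G'\<in>{G'\<in>Obs. \<psi> G' = G}. \<alpha> G')" for G
  proof -
    have "joint (insert h A) G = subset_prob p E (\<lambda>H. A \<subseteq> H \<and> h \<in> H - A \<and> \<phi> H = G)"
      unfolding joint_def by (rule arg_cong[where f = "subset_prob p E"]) (use h in auto)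
    then show ?thesis using split[of "\<lambda>H. h \<in> H" G] by (simp only: \<alpha>_def)
  qed
  \<comment> \<open>Counting only the sets that contain \<open>A\<close> is enough, because
    \<open>marg\<close> will stand in a denominator.\<close>
  have marg_ge: "r * (\<Sum>G'\<in>{G'\<in>Obs. \<psi> G' = G}. \<beta> G') \<le> marg G" for G
  proof -
    have "r * (\<Sum>G'\<in>{G'\<in>Obs. \<psi> G' = G}. \<beta> G') = joint A G"
      using split[of "\<lambda>_. True" G] by (simp add: joint_def \<beta>_def)
    then show ?thesis using joint_antimono[of "{}" A G] by simp
  qed
  have "posterior_sq (insert h A) \<le> (\<Sum>G\<in>Obs. r * (\<Sum>G'\<in>{G'\<in>Obs. \<psi> G' = G}. (\<alpha> G')\<^sup>2 / \<beta> G'))"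
    unfolding posterior_sq_def
  proof (rule sum_mono)
    fix G assume G: "G \<in> Obs"
    let ?F = "{G'\<in>Obs. \<psi> G' = G}"
    have "(joint (insert h A) G)\<^sup>2 = r\<^sup>2 * (sum \<alpha> ?F)\<^sup>2"
      by (simp add: joint_eq power_mult_distrib)
    \<comment> \<open>Convexity: merging observations can only decrease a sum of terms
      \<open>a^2 / b\<close>.\<close>
    also have "\<dots> \<le> r\<^sup>2 * ((\<Sum>G'\<in>?F. (\<alpha> G')\<^sup>2 / \<beta> G') * sum \<beta> ?F)"
      by (intro mult_left_mono sedrakyan_sum \<alpha>_nonneg \<alpha>_le_\<beta>) auto
    also have "\<dots> = r * (\<Sum>G'\<in>?F. (\<alpha> G')\<^sup>2 / \<beta> G') * (r * sum \<beta> ?F)"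
      by (simp add: power2_eq_square)
    also have "\<dots> \<le> r * (\<Sum>G'\<in>?F. (\<alpha> G')\<^sup>2 / \<beta> G') * marg G"
      by (intro mult_left_mono marg_ge mult_nonneg_nonneg sum_nonneg divide_nonneg_nonneg)
         (use r_pos \<beta>_nonneg in auto)
    finally show "(joint (insert h A) G)\<^sup>2 / marg G \<le> r * (\<Sum>G'\<in>?F. (\<alpha> G')\<^sup>2 / \<beta> G')"
      using marg_pos[OF G] by (simp add: divide_le_eq)
  qed
  \<comment> \<open>Observations outside the image of \<open>\<psi>\<close> have empty fibres.
    Enlarging the index set to the whole image next lets the fibres reassemble into
    \<open>Obs\<close>.\<close>
  also have "\<dots> = r * (\<Sum>G\<in>\<psi> ` Obs \<inter> Obs. \<Sum>G'\<in>{G'\<in>Obs. \<psi> G' = G}. (\<alpha> G')\<^sup>2 / \<beta> G')"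
    unfolding sum_distrib_left[symmetric]
  proof (intro arg_cong[where f = "(*) r"] sum.mono_neutral_right finite_Obs ballI)
    fix G assume "G \<in> Obs - \<psi> ` Obs \<inter> Obs"
    then have "{G'\<in>Obs. \<psi> G' = G} = {}" by blast
    then show "(\<Sum>G'\<in>{G'\<in>Obs. \<psi> G' = G}. (\<alpha> G')\<^sup>2 / \<beta> G') = 0" by (simp only: sum.empty)
  qed blast
  also have "\<dots> \<le> r * (\<Sum>G\<in>\<psi> ` Obs. \<Sum>G'\<in>{G'\<in>Obs. \<psi> G' = G}. (\<alpha> G')\<^sup>2 / \<beta> G')"
    by (intro mult_left_mono sum_mono2 sum_nonneg divide_nonneg_nonneg)
       (use r_pos \<beta>_nonneg finite_Obs in auto)
  also have "\<dots> = r * (\<Sum>G\<in>Obs. (\<alpha> G)\<^sup>2 / \<beta> G)"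
    using sum.image_gen[OF finite_Obs, of "\<lambda>G. (\<alpha> G)\<^sup>2 / \<beta> G" \<psi>] by simp
  also have "(\<Sum>G\<in>Obs. (\<alpha> G)\<^sup>2 / \<beta> G)
      \<le> (\<Sum>G\<in>Obs. 2 * ((joint {h} G)\<^sup>2 / marg G)
          + (\<Sum>a\<in>A. (joint {h} G)\<^sup>2 / marg G + (joint {a} G)\<^sup>2 / marg G))"
  proof (rule sum_mono)
    fix G assume G: "G \<in> Obs"
    define a where "a = joint {h} G"
    define g where "g = marg G"
    have g: "0 < g" using marg_pos[OF G] by (simp add: g_def)
    have a: "\<alpha> G \<le> a" "0 \<le> a" using \<alpha>_le_joint joint_nonneg by (auto simp: a_def)
    show "(\<alpha> G)\<^sup>2 / \<beta> G \<le> 2 * (a\<^sup>2 / g) + (\<Sum>b\<in>A. a\<^sup>2 / g + (joint {b} G)\<^sup>2 / g)"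
    \<comment> \<open>Either \<open>A\<close> is avoided with conditional probability at least 1/2,
      and replacing \<open>\<beta> G\<close> by \<open>g / 2\<close> costs a factor 2, or the
      posteriors of the members of \<open>A\<close> sum to at least 1/2.\<close>
    proof (cases "g \<le> 2 * \<beta> G")
      case True
      then have "(\<alpha> G)\<^sup>2 / \<beta> G \<le> a\<^sup>2 / (g / 2)"
        using g a \<alpha>_nonneg by (intro frac_le power_mono) auto
      moreover have "0 \<le> (\<Sum>b\<in>A. a\<^sup>2 / g + (joint {b} G)\<^sup>2 / g)"
        using g by (intro sum_nonneg) auto
      ultimately show ?thesis by (simp add: mult.commute)
    next
      case False
      have "g \<le> \<beta> G + (\<Sum>b\<in>A. joint {b} G)"
      proof -
        \<comment> \<open>Union bound: \<open>None\<close> stands for the event that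
          \<open>A\<close> is avoided, \<open>Some b\<close> for the event that \<open>b\<close> is
          present.\<close>
        have "g \<le> (\<Sum>i\<in>insert None (Some ` A). subset_prob p E
            (case i of None \<Rightarrow> \<lambda>H. A \<inter> H = {} \<and> \<phi> H = G | Some b \<Rightarrow> \<lambda>H. {b} \<subseteq> H \<and> \<phi> H = G))"
          unfolding g_def joint_def
          by (rule subset_prob_union_bound) (use finite_E finA p_pos p_less_1 in auto)
        also have "\<dots> = \<beta> G + (\<Sum>b\<in>A. joint {b} G)"
          using finA by (simp add: sum.reindex \<beta>_def joint_def)
        finally show ?thesis .
      qed
      then have "g \<le> 2 * (\<Sum>b\<in>A. joint {b} G)" using False by linarith
      then have 1: "a \<le> a * (2 * (\<Sum>b\<in>A. joint {b} G)) / g"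
        using mult_left_mono[of g "2 * (\<Sum>b\<in>A. joint {b} G)" a] g a by (simp add: le_divide_eq)
      have "(\<alpha> G)\<^sup>2 / \<beta> G \<le> \<alpha> G"
      proof (cases "\<beta> G = 0")
        case False
        then show ?thesis
          using \<alpha>_le_\<beta>[of G] \<alpha>_nonneg[of G] \<beta>_nonneg[of G]
          by (auto simp: divide_le_eq power2_eq_square intro!: mult_left_mono)
      qed (use \<alpha>_nonneg in auto)
      also have "\<dots> \<le> a * (2 * (\<Sum>b\<in>A. joint {b} G)) / g" using 1 a by linarith
      also have "\<dots> = (\<Sum>b\<in>A. 2 * a * joint {b} G / g)"
        by (simp add: sum_distrib_left sum_divide_distrib mult_ac)
      \<comment> \<open>\<open>2 * x * y \<le> x^2 + y^2\<close> turns the mixed terms into second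
        moments of single posteriors.\<close>
      also have "\<dots> \<le> (\<Sum>b\<in>A. a\<^sup>2 / g + (joint {b} G)\<^sup>2 / g)"
        unfolding add_divide_distrib[symmetric]
        by (intro sum_mono divide_right_mono sum_squares_bound) (use g in auto)
      also have "\<dots> \<le> 2 * (a\<^sup>2 / g) + \<dots>" using g by simp
      finally show ?thesis .
    qed
  qed
  also have "\<dots> = 2 * posterior_sq {h} + (\<Sum>a\<in>A. posterior_sq {h} + posterior_sq {a})"
    unfolding posterior_sq_def sum.distrib sum_distrib_left[symmetric]
    by (subst sum.swap, subst sum.swap) (simp add: sum.swap[of _ A])
  also have "\<dots> \<le> 2 * s + (\<Sum>a\<in>A. s + s)"
    by (intro add_mono mult_left_mono sum_mono s) (use h A in auto)
  also have "\<dots> = 2 * real (Suc (card A)) * s" by (simp add: algebra_simps)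
  finally show ?thesis using r_pos unfolding r_def by (simp add: mult_left_mono)
qed

end

section \<open>Projections of random hypergraphs\<close>

text \<open>The product pmf with default \<open>False\<close> is supported on predicates that vanish
  off \<open>E\<close>, and these correspond to the subsets of \<open>E\<close>.\<close>

lemma prob_random_hypergraph:
  assumes "0 \<le> p" "p \<le> 1"
  shows "measure (measure_pmf (random_hypergraph d n p)) {H. Q H} = subset_prob p (nsets {1..n} d) Q"
proof -
  define E where "E = nsets {1..n} d"
  have fin: "finite E" by (simp add: E_def finite_imp_finite_nsets)
  let ?M = "Pi_pmf E False (\<lambda>_. bernoulli_pmf p)"
  let ?S = "{H. H \<subseteq> E \<and> Q H}"
  have finS: "finite ?S" using fin by simp
  have inj: "inj_on (\<lambda>H h. h \<in> H) ?S" by (auto simp: inj_on_def fun_eq_iff)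
  have "measure (measure_pmf (random_hypergraph d n p)) {H. Q H}
      = measure (measure_pmf ?M) {\<omega>. Q {h \<in> E. \<omega> h}}"
    by (simp add: random_hypergraph_def E_def vimage_def)
  \<comment> \<open>The two events agree only almost surely: the first also contains predicates that
    are true somewhere outside \<open>E\<close>.\<close>
  also have "\<dots> = measure (measure_pmf ?M) ((\<lambda>H h. h \<in> H) ` ?S)"
  proof (rule measure_eq_AE)
    show "AE \<omega> in measure_pmf ?M. (\<omega> \<in> {\<omega>. Q {h \<in> E. \<omega> h}}) = (\<omega> \<in> (\<lambda>H h. h \<in> H) ` ?S)"
    proof (rule AE_pmfI)
      fix \<omega> assume "\<omega> \<in> set_pmf ?M"
      then have \<omega>: "\<not> \<omega> h" if "h \<notin> E" for h
        using set_Pi_pmf_subset[OF fin, of False "\<lambda>_. bernoulli_pmf p"] that by auto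
      then have "\<omega> = (\<lambda>h. h \<in> {h \<in> E. \<omega> h})" by auto
      moreover have "{h \<in> E. h \<in> H} = H" if "H \<subseteq> E" for H using that by auto
      ultimately show "(\<omega> \<in> {\<omega>. Q {h \<in> E. \<omega> h}}) = (\<omega> \<in> (\<lambda>H h. h \<in> H) ` ?S)"
        by (auto intro!: image_eqI[of _ _ "{h \<in> E. \<omega> h}"])
    qed
  qed auto
  also have "\<dots> = (\<Sum>H\<in>?S. pmf ?M (\<lambda>h. h \<in> H))"
    using finS by (simp add: measure_measure_pmf_finite sum.reindex[OF inj])
  also have "\<dots> = subset_prob p E Q"
    unfolding subset_prob_def
  proof (rule sum.cong[OF refl])
    fix H assume H: "H \<in> ?S"
    then have "pmf ?M (\<lambda>h. h \<in> H) = (\<Prod>h\<in>E. pmf (bernoulli_pmf p) (h \<in> H))"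
      by (intro pmf_Pi') (use fin in auto)
    also have "\<dots> = (\<Prod>h\<in>E. if h \<in> H then p else 1 - p)"
      by (rule prod.cong) (use assms in auto)
    also have "\<dots> = bernoulli_weight p E H"
      using H fin by (simp add: bernoulli_weight_eq_prod)
    finally show "pmf ?M (\<lambda>h. h \<in> H) = bernoulli_weight p E H" .
  qed
  finally show ?thesis by (simp add: E_def)
qed

section \<open>Projections as unions of pair sets\<close>

lemma Proj_Un: "Proj n (H \<union> A) = Proj n H \<union> Proj n A"
  unfolding Proj_def
  by (simp add: bex_Un conj_disj_distribL ex_disj_distrib Collect_disj_eq)

lemma Proj_subset_nsets: "Proj n H \<subseteq> nsets {1..n} 2"
  unfolding Proj_def by auto

lemma Proj_eq_UN:
  assumes "H \<subseteq> nsets {1..n} d"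
  shows "Proj n H = (\<Union>h\<in>H. nsets h 2)"
proof (intro equalityI subsetI)
  fix e assume "e \<in> Proj n H"
  then show "e \<in> (\<Union>h\<in>H. nsets h 2)" unfolding Proj_def by auto
next
  fix e assume "e \<in> (\<Union>h\<in>H. nsets h 2)"
  then obtain h where h: "h \<in> H" "e \<in> nsets h 2" by auto
  then obtain i j where "e = {i, j}" "i \<in> h" "j \<in> h" "i \<noteq> j" by (auto elim: nsets2_E)
  moreover have "h \<subseteq> {1..n}" using assms h by (auto simp: nsets_def)
  ultimately show "e \<in> Proj n H" using h(1) unfolding Proj_def by blast
qed

lemma card_Proj_le:
  assumes "H \<subseteq> nsets {1..n} d"
  shows "card (Proj n H) \<le> (d choose 2) * card H"
proof -
  have fin: "finite H" using assms by (rule finite_subset) (simp add: finite_imp_finite_nsets)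
  have "card (Proj n H) \<le> (\<Sum>h\<in>H. card (nsets h 2))"
    unfolding Proj_eq_UN[OF assms] by (rule card_UN_le[OF fin])
  also have "\<dots> = (\<Sum>h\<in>H. d choose 2)"
  proof (rule sum.cong[OF refl])
    fix h assume "h \<in> H"
    then have "card h = d" using assms by (auto simp: nsets_def)
    then show "card (nsets h 2) = d choose 2" by simp
  qed
  finally show ?thesis by (simp add: mult.commute)
qed

section \<open>Symmetry under permutations of the vertices\<close>

lemma ex_bij_betw_image_eq:
  assumes "finite V" "h \<subseteq> V" "h' \<subseteq> V" "card h = card h'"
  obtains \<pi> where "bij_betw \<pi> V V" "\<pi> ` h = h'"
proof -
  have fin: "finite h" "finite h'" using assms by (auto intro: finite_subset)
  have "card (V - h) = card (V - h')" using assms fin by (simp add: card_Diff_subset)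
  then obtain g where g: "bij_betw g (V - h) (V - h')"
    using assms(1) finite_same_card_bij[of "V - h" "V - h'"] by auto
  obtain f where f: "bij_betw f h h'"
    using finite_same_card_bij[OF fin assms(4)] by blast
  let ?\<pi> = "\<lambda>x. if x \<in> h then f x else g x"
  have "bij_betw ?\<pi> (h \<union> (V - h)) (h' \<union> (V - h'))"
    using f g by (intro bij_betw_disjoint_Un) auto
  then have "bij_betw ?\<pi> V V"
    using assms by (simp add: Un_absorb1)
  moreover have "?\<pi> ` h = h'" using f by (auto simp: bij_betw_def)
  ultimately show ?thesis by (rule that)
qed

lemma nsets_image:
  assumes "inj_on f A"
  shows "nsets (f ` A) k = image f ` nsets A k"
proof (intro equalityI subsetI)
  fix B assume "B \<in> nsets (f ` A) k"
  then have B: "B \<subseteq> f ` A" "finite B" "card B = k" by (auto simp: nsets_def)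
  then obtain C where C: "C \<subseteq> A" "B = f ` C" by (auto simp: subset_image_iff)
  have "inj_on f C" using assms C(1) by (rule inj_on_subset)
  then have "C \<in> nsets A k" using B C by (auto simp: nsets_def card_image finite_image_iff)
  then show "B \<in> image f ` nsets A k" using C by auto
next
  fix B assume "B \<in> image f ` nsets A k"
  then show "B \<in> nsets (f ` A) k"
    using assms by (auto simp: nsets_def card_image inj_on_subset)
qed

text \<open>A vertex permutation taking \<open>h\<close> to \<open>h'\<close> acts on hyperedges and
  on edges, and \<open>Proj n\<close> commutes with these actions.\<close>

lemma posterior_sq_Proj_eq:
  assumes "0 < p" "p < 1" "h \<in> nsets {1..n} d" "h' \<in> nsets {1..n} d"
  shows "observed_subset.posterior_sq p (nsets {1..n} d) (Proj n) {h'}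
    = observed_subset.posterior_sq p (nsets {1..n} d) (Proj n) {h}"
proof -
  interpret observed_subset p "nsets {1..n} d" "Proj n"
    by unfold_locales (use assms in \<open>auto simp: finite_imp_finite_nsets\<close>)
  obtain \<pi> where \<pi>: "bij_betw \<pi> {1..n} {1..n}" "\<pi> ` h = h'"
    by (rule ex_bij_betw_image_eq[of "{1..n}" h h']) (use assms in \<open>auto simp: nsets_def\<close>)
  have inj: "inj_on \<pi> {1..n}" using \<pi>(1) by (simp add: bij_betw_def)
  have bij: "bij_betw (image \<pi>) (nsets {1..n} k) (nsets {1..n} k)" for k
    by (rule bij_betw_nsets[OF \<pi>(1)])
  have "posterior_sq {\<pi> ` h} = posterior_sq {h}"
  proof (rule posterior_sq_image[OF bij assms(3), where \<Psi> = "image (image \<pi>)"])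
    show "inj_on (image (image \<pi>)) Obs"
    proof (rule inj_on_subset)
      show "inj_on (image (image \<pi>)) (Pow (nsets {1..n} 2))"
        by (rule inj_on_image_Pow) (use bij[of 2] in \<open>simp add: bij_betw_def\<close>)
    qed (use Proj_subset_nsets in auto)
  next
    fix H assume H: "H \<subseteq> nsets {1..n} d"
    have "image \<pi> ` H \<subseteq> nsets {1..n} d"
      using bij[of d] H by (auto simp: bij_betw_def)
    then have "Proj n (image \<pi> ` H) = (\<Union>h\<in>H. nsets (\<pi> ` h) 2)"
      by (simp add: Proj_eq_UN)
    also have "\<dots> = (\<Union>h\<in>H. image \<pi> ` nsets h 2)"
    proof (intro SUP_cong refl nsets_image)
      fix h assume "h \<in> H"
      then have "h \<subseteq> {1..n}" using H by (auto simp: nsets_def)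
      then show "inj_on \<pi> h" by (rule inj_on_subset[OF inj])
    qed
    also have "\<dots> = image \<pi> ` Proj n H"
      unfolding Proj_eq_UN[OF H] by blast
    finally show "Proj n (image \<pi> ` H) = image \<pi> ` Proj n H" .
  qed
  then show ?thesis by (simp add: \<pi>(2))
qed

section \<open>The probability that the projection contains a given clique\<close>

lemma card_nsets_fixed_trace_le:
  assumes "S \<subseteq> h"
  shows "card {e \<in> nsets {1..n} d. e \<inter> h = S} \<le> n ^ (d - card S)"
proof -
  have "card {e \<in> nsets {1..n} d. e \<inter> h = S} \<le> card (nsets {1..n} (d - card S))"
  proof (rule card_inj_on_le)
    show "inj_on (\<lambda>e. e - S) {e \<in> nsets {1..n} d. e \<inter> h = S}"
      by (rule inj_onI) blast
    show "(\<lambda>e. e - S) ` {e \<in> nsets {1..n} d. e \<inter> h = S} \<subseteq> nsets {1..n} (d - card S)"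
    proof clarify
      fix e assume e: "e \<in> nsets {1..n} d" "S = e \<inter> h"
      then have "finite e" "card e = d" "e \<subseteq> {1..n}" by (auto simp: nsets_def)
      then show "e - e \<inter> h \<in> nsets {1..n} (d - card (e \<inter> h))"
        by (auto simp: nsets_def card_Diff_subset finite_subset[of "e \<inter> h" e])
    qed
  qed (simp add: finite_imp_finite_nsets)
  also have "\<dots> = n choose (d - card S)" by simp
  also have "\<dots> \<le> (n choose (d - card S)) * fact (d - card S)" by simp
  also have "\<dots> \<le> n ^ (d - card S)" by (rule binomial_fact_pow)
  finally show ?thesis .
qed

text \<open>
  A union bound over the set \<open>F\<close> of traces \<open>e \<inter> h\<close>: hyperedges with different traces are different,
  hence independent, and since \<open>F\<close> covers all pairs in \<open>h\<close> the exponents of \<open>q\<close> add up to at least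
  \<open>d choose 2\<close>.
\<close>

lemma prob_clique_le:
  assumes p: "0 \<le> p" "p \<le> 1" and q: "0 \<le> q" "q \<le> 1" and h: "h \<in> nsets {1..n} d"
    and pq: "\<And>s. 2 \<le> s \<Longrightarrow> s \<le> d \<Longrightarrow> real n ^ (d - s) * p \<le> q ^ (s choose 2)"
  shows "subset_prob p (nsets {1..n} d) (\<lambda>H. nsets h 2 \<subseteq> Proj n H) \<le> 2 ^ 2 ^ d * q ^ (d choose 2)"
proof -
  define E where "E = nsets {1..n} d"
  have finE: "finite E" by (simp add: E_def finite_imp_finite_nsets)
  have finh: "finite h" and cardh: "card h = d" using h by (auto simp: nsets_def)
  \<comment> \<open>The candidate families of traces that cover every pair of \<open>h\<close>;
    traces with fewer than two vertices cover none. The trace \<open>h\<close> itself is allowed and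
    means that \<open>h\<close> is a hyperedge.\<close>
  define \<F> where "\<F> = {F. F \<subseteq> {S. S \<subseteq> h \<and> 2 \<le> card S} \<and> nsets h 2 \<subseteq> (\<Union>S\<in>F. nsets S 2)}"
  have \<F>_sub: "\<F> \<subseteq> Pow (Pow h)" unfolding \<F>_def by auto
  have fin\<F>: "finite \<F>" using finh by (intro finite_subset[OF \<F>_sub]) auto
  have "card \<F> \<le> card (Pow (Pow h))" using finh by (intro card_mono \<F>_sub) auto
  then have card\<F>: "card \<F> \<le> 2 ^ 2 ^ d" using finh by (simp add: card_Pow cardh)
  have "subset_prob p E (\<lambda>H. nsets h 2 \<subseteq> Proj n H)
      \<le> (\<Sum>F\<in>\<F>. subset_prob p E (\<lambda>H. \<forall>S\<in>F. \<exists>e\<in>H. e \<inter> h = S))"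
  proof (rule subset_prob_union_bound[OF finE p fin\<F>])
    fix H assume H: "H \<subseteq> E" "nsets h 2 \<subseteq> Proj n H"
    let ?F = "{e \<inter> h |e. e \<in> H \<and> 2 \<le> card (e \<inter> h)}"
    have "nsets h 2 \<subseteq> (\<Union>S\<in>?F. nsets S 2)"
    proof
      fix u assume u: "u \<in> nsets h 2"
      then obtain e where e: "e \<in> H" "u \<in> nsets e 2"
        using H Proj_eq_UN[of H n d] by (auto simp: E_def)
      then have "u \<in> nsets (e \<inter> h) 2" using u by (auto simp: nsets_def)
      moreover have "2 \<le> card (e \<inter> h)"
        using calculation card_mono[of "e \<inter> h" u] finh by (auto simp: nsets_def)
      ultimately show "u \<in> (\<Union>S\<in>?F. nsets S 2)" using e(1) by blast
    qed
    then have "?F \<in> \<F>" unfolding \<F>_def by auto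
    then show "\<exists>F\<in>\<F>. \<forall>S\<in>F. \<exists>e\<in>H. e \<inter> h = S" by (rule bexI[rotated]) auto
  qed
  also have "\<dots> \<le> (\<Sum>F\<in>\<F>. q ^ (d choose 2))"
  proof (rule sum_mono)
    fix F assume F: "F \<in> \<F>"
    define X where "X S = {e \<in> E. e \<inter> h = S}" for S
    have FS: "S \<subseteq> h" "2 \<le> card S" "card S \<le> d" if "S \<in> F" for S
      using F that finh cardh by (auto simp: \<F>_def intro: card_mono)
    have finF: "finite F" using F \<F>_sub finh by (meson PowD finite_Pow_iff finite_subset subsetD)
    have finX: "finite (X S)" for S using finE by (simp add: X_def)
    have "subset_prob p E (\<lambda>H. \<forall>S\<in>F. \<exists>e\<in>H. e \<inter> h = S)
        \<le> (\<Sum>e\<in>PiE F X. subset_prob p E (\<lambda>H. e ` F \<subseteq> H))"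
    proof (rule subset_prob_union_bound[OF finE p])
      show "finite (PiE F X)" using finF finX by (intro finite_PiE) auto
      fix H assume H: "H \<subseteq> E" "\<forall>S\<in>F. \<exists>e\<in>H. e \<inter> h = S"
      then obtain e where e: "\<forall>S\<in>F. e S \<in> H \<and> e S \<inter> h = S" by metis
      have "restrict e F \<in> PiE F X" using e H by (auto simp: X_def)
      moreover have "restrict e F ` F \<subseteq> H" using e by auto
      ultimately show "\<exists>e\<in>PiE F X. e ` F \<subseteq> H" by blast
    qed
    also have "\<dots> = (\<Sum>e\<in>PiE F X. p ^ card F)"
    proof (rule sum.cong[OF refl])
      fix e assume e: "e \<in> PiE F X"
      have eX: "e S \<in> X S" if "S \<in> F" for S using e that by (rule PiE_mem)
      \<comment> \<open>The trace is recovered as \<open>e S \<inter> h\<close>, so the chosen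
        hyperedges are distinct and \<open>card F\<close> independent factors \<open>p\<close>
        arise.\<close>
      have "inj_on e F"
        by (rule inj_on_inverseI[where g = "\<lambda>u. u \<inter> h"]) (use eX in \<open>simp add: X_def\<close>)
      moreover have "e ` F \<subseteq> E" using eX by (auto simp: X_def)
      ultimately show "subset_prob p E (\<lambda>H. e ` F \<subseteq> H) = p ^ card F"
        using finE by (simp add: subset_prob_supset card_image)
    qed
    also have "\<dots> = (\<Prod>S\<in>F. real (card (X S)) * p)"
      using finF by (simp add: card_PiE prod.distrib)
    also have "\<dots> \<le> (\<Prod>S\<in>F. q ^ (card S choose 2))"
    proof (rule prod_mono)
      fix S assume S: "S \<in> F"
      have "real (card (X S)) \<le> real n ^ (d - card S)"
        using card_nsets_fixed_trace_le[of S h n d] FS[OF S] by (simp add: X_def E_def flip: of_nat_power)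
      then have "real (card (X S)) * p \<le> real n ^ (d - card S) * p"
        using p by (intro mult_right_mono) auto
      also have "\<dots> \<le> q ^ (card S choose 2)" using FS[OF S] by (intro pq)
      finally show "0 \<le> real (card (X S)) * p \<and> real (card (X S)) * p \<le> q ^ (card S choose 2)"
        using p by simp
    qed
    also have "\<dots> = q ^ (\<Sum>S\<in>F. card S choose 2)" by (simp add: power_sum)
    also have "\<dots> \<le> q ^ (d choose 2)"
    proof (rule power_decreasing)
      have "d choose 2 = card (nsets h 2)" by (simp add: cardh)
      also have "\<dots> \<le> card (\<Union>S\<in>F. nsets S 2)"
        using F finF FS finh
        by (intro card_mono) (auto simp: \<F>_def intro!: finite_imp_finite_nsets intro: finite_subset)
      also have "\<dots> \<le> (\<Sum>S\<in>F. card (nsets S 2))" by (rule card_UN_le[OF finF])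
      finally show "d choose 2 \<le> (\<Sum>S\<in>F. card S choose 2)" by simp
    qed (use q in auto)
    finally show "subset_prob p E (\<lambda>H. \<forall>S\<in>F. \<exists>e\<in>H. e \<inter> h = S) \<le> q ^ (d choose 2)" .
  qed
  also have "\<dots> \<le> 2 ^ 2 ^ d * q ^ (d choose 2)"
  proof -
    have "real (card \<F>) \<le> 2 ^ 2 ^ d" using card\<F> by (metis numeral_power_le_of_nat_cancel_iff of_nat_le_iff of_nat_numeral of_nat_power)
    then show ?thesis using q by (simp add: mult_right_mono)
  qed
  finally show ?thesis by (simp add: E_def)
qed

text \<open>\<open>entropy_bound\<close> with the Bernoulli graph of density \<open>q\<close> as
  \<open>R\<close> bounds the sum of the single-hyperedge terms. Adding
  \<open>posterior_sq_bound\<close> over all hyperedges then cancels \<open>ln M\<close>. At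
  \<open>s = d\<close> the assumption \<open>pq\<close> also gives \<open>M \<ge> 1\<close>.\<close>

lemma posterior_sq_Proj_bound:
  assumes p: "0 < p" "p < 1" and d: "2 \<le> d" "d \<le> n"
    and q_def: "q = real n ^ (d - 2) * p" and q: "q \<le> 1 / 2"
    and pq: "\<And>s. 2 \<le> s \<Longrightarrow> s \<le> d \<Longrightarrow> real n ^ (d - s) * p \<le> q ^ (s choose 2)"
    and h: "h \<in> nsets {1..n} d"
  shows "observed_subset.posterior_sq p (nsets {1..n} d) (Proj n) {h} * ln (q ^ (d choose 2) / p)
    \<le> 2 * p * (real d ^ d + 2 + 2 ^ 2 ^ d)"
proof -
  define E where "E = nsets {1..n} d"
  have finE: "finite E" by (simp add: E_def finite_imp_finite_nsets)
  interpret observed_subset p E "Proj n"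
    by unfold_locales (use p finE in auto)
  define N where "N = card E"
  have N_eq: "N = n choose d" by (simp add: N_def E_def)
  have N_pos: "0 < N" using d by (simp add: N_eq)
  define C where "C = d choose 2"
  define M where "M = q ^ C / p"
  have q_pos: "0 < q" using p d by (simp add: q_def)
  have M_ge: "1 \<le> M" using pq[of d] d p by (simp add: M_def C_def)
  have lnM: "ln M = real C * ln q - ln p"
    using q_pos p by (simp add: M_def ln_div ln_realpow)
  define V where "V = nsets {1..n} 2"
  have finV: "finite V" by (simp add: V_def finite_imp_finite_nsets)
  have PV: "Proj n H \<subseteq> V" for H unfolding V_def by (rule Proj_subset_nsets)

  \<comment> \<open>The factor 2 anticipates \<open>ln (1 - q) \<ge> - 2 * q\<close>, so this bounds
    the total cost of non-edges. It follows from \<open>q * n^2 = n^d * p\<close> and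
    \<open>(n choose d) \<ge> (n / d)^d\<close>.\<close>
  have edges: "2 * q * real (card V) \<le> real d ^ d * (real N * p)"
  proof -
    have "card V * 2 \<le> n ^ 2"
      using binomial_fact_pow[of n 2] by (simp add: V_def fact_numeral)
    then have "2 * real (card V) \<le> real n ^ 2" by (simp flip: of_nat_power add: mult.commute)
    then have "2 * real (card V) * q \<le> real n ^ 2 * q"
      using q_pos by (intro mult_right_mono) auto
    also have "\<dots> = real n ^ d * p"
    proof -
      have "real n ^ 2 * real n ^ (d - 2) = real n ^ d"
        by (metis d(1) le_add_diff_inverse power_add)
      then show ?thesis by (simp only: q_def mult.assoc[symmetric])
    qed
    also have "real n ^ d \<le> real d ^ d * real N"
    proof -
      have "(real n / real d) ^ d \<le> real N"
        using binomial_ge_n_over_k_pow_k[OF d(2), where 'a = real] by (simp add: N_eq)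
      then show ?thesis using d by (simp add: power_divide divide_le_eq mult.commute)
    qed
    finally show ?thesis using p by (simp add: mult_ac)
  qed

  \<comment> \<open>Minus the conditional entropy of the indicator of \<open>h\<close> given the
    projection.\<close>
  define Ent where "Ent h = (\<Sum>G\<in>Obs. marg G * (post h G * ln (post h G) + (1 - post h G) * ln (1 - post h G)))" for h
  have "(\<Sum>H\<in>Pow E. wt H * ln (bernoulli_weight q V (Proj n H))) + (\<Sum>h\<in>E. Ent h)
      \<le> (\<Sum>H\<in>Pow E. wt H * ln (wt H))"
    unfolding Ent_def
  proof (rule entropy_bound)
    show "0 < bernoulli_weight q V G" for G
      using q_pos q by (simp add: bernoulli_weight_def)
    have "(\<Sum>G\<in>Obs. bernoulli_weight q V G) \<le> (\<Sum>G\<in>Pow V. bernoulli_weight q V G)"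
      by (rule sum_mono2) (use finV PV q_pos q in \<open>auto simp: bernoulli_weight_def\<close>)
    then show "(\<Sum>G\<in>Obs. bernoulli_weight q V G) \<le> 1"
      by (simp add: sum_bernoulli_weight[OF finV])
  qed
  moreover have "(\<Sum>H\<in>Pow E. wt H * ln (wt H)) \<le> real N * p * ln p"
  proof -
    have "ln (wt H) \<le> real (card H) * ln p" for H
    proof -
      have "ln (wt H) = real (card H) * ln p + real (card (E - H)) * ln (1 - p)"
        using p by (simp add: bernoulli_weight_def ln_mult ln_realpow)
      moreover have "real (card (E - H)) * ln (1 - p) \<le> 0"
        using p by (intro mult_nonneg_nonpos) auto
      ultimately show ?thesis by simp
    qed
    then have "(\<Sum>H\<in>Pow E. wt H * ln (wt H)) \<le> (\<Sum>H\<in>Pow E. wt H * (real (card H) * ln p))"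
      by (intro sum_mono mult_left_mono) (auto intro: less_imp_le wt_pos)
    also have "\<dots> = (\<Sum>H\<in>Pow E. wt H * real (card H)) * ln p"
      by (simp add: sum_distrib_right mult.assoc)
    also have "\<dots> = real N * p * ln p"
      by (simp add: sum_card_bernoulli_weight[OF finE] N_def)
    finally show ?thesis .
  qed
  \<comment> \<open>Each hyperedge creates at most \<open>C\<close> edges. Since \<open>ln q\<close>
    is negative, the log-weight of the projection is at least \<open>C * ln q\<close> per hyperedge,
    up to the cost of non-edges.\<close>
  moreover have "real N * p * (real C * ln q) - real d ^ d * (real N * p)
      \<le> (\<Sum>H\<in>Pow E. wt H * ln (bernoulli_weight q V (Proj n H)))"
  proof -
    have "real N * p * (real C * ln q) - real d ^ d * (real N * p)
        \<le> real N * p * (real C * ln q) - 2 * q * real (card V)"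
      using edges by simp
    also have "\<dots> = (\<Sum>H\<in>Pow E. wt H * real (card H)) * (real C * ln q)
        - (\<Sum>H\<in>Pow E. wt H) * (2 * q * real (card V))"
      by (simp add: sum_card_bernoulli_weight[OF finE] sum_bernoulli_weight[OF finE] N_def)
    also have "\<dots> = (\<Sum>H\<in>Pow E. wt H * (real (card H) * (real C * ln q) - 2 * q * real (card V)))"
      by (simp only: sum_distrib_right right_diff_distrib sum_subtractf mult.assoc)
    also have "\<dots> \<le> (\<Sum>H\<in>Pow E. wt H * ln (bernoulli_weight q V (Proj n H)))"
    proof (intro sum_mono mult_left_mono)
      fix H assume H: "H \<in> Pow E"
      have "card (Proj n H) \<le> C * card H"
        using card_Proj_le[of H n d] H by (simp add: E_def C_def)
      then have "real (card (Proj n H)) \<le> real C * real (card H)"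
        by (simp flip: of_nat_mult)
      then have 1: "real C * real (card H) * ln q \<le> real (card (Proj n H)) * ln q"
        using q_pos q by (intro mult_right_mono_neg) auto
      have "- q - 2 * q\<^sup>2 \<le> ln (1 - q)"
        using q_pos q by (intro ln_one_minus_pos_lower_bound) auto
      moreover have "q\<^sup>2 \<le> q / 2"
        using q_pos q by (simp add: power2_eq_square mult_left_mono[of q "1 / 2" q, simplified])
      ultimately have "- (2 * q) \<le> ln (1 - q)" by simp
      then have "real (card (V - Proj n H)) * - (2 * q) \<le> real (card (V - Proj n H)) * ln (1 - q)"
        by (intro mult_left_mono) auto
      moreover have "real (card (V - Proj n H)) * (2 * q) \<le> real (card V) * (2 * q)"
        using q_pos finV by (intro mult_right_mono) (auto intro: card_mono)
      ultimately have 2: "- (2 * q * real (card V)) \<le> real (card (V - Proj n H)) * ln (1 - q)"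
        by (simp add: mult_ac)
      have "ln (bernoulli_weight q V (Proj n H))
          = real (card (Proj n H)) * ln q + real (card (V - Proj n H)) * ln (1 - q)"
        using q_pos q by (simp add: bernoulli_weight_def ln_mult ln_realpow)
      then show "real (card H) * (real C * ln q) - 2 * q * real (card V)
          \<le> ln (bernoulli_weight q V (Proj n H))"
        using 1 2 by (simp add: mult_ac)
    qed (auto intro: less_imp_le wt_pos)
    finally show ?thesis .
  qed
  ultimately have Ent_le: "(\<Sum>h\<in>E. Ent h) \<le> real N * p * (real d ^ d - ln M)"
    unfolding lnM by (simp add: algebra_simps)

  let ?S = "posterior_sq {h}"
  \<comment> \<open>By symmetry the left side does not depend on \<open>h'\<close>, so this can be
    summed over all hyperedges.\<close>
  have "?S * ln M / 2 \<le> p * (ln M + 2) + 2 ^ 2 ^ d * p + Ent h'" if h': "h' \<in> E" for h'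
  proof -
    have "?S * ln M / 2 = posterior_sq {h'} * ln M / 2"
      using posterior_sq_Proj_eq[OF p h, of h'] h' by (simp add: E_def)
    also have "\<dots> \<le> p * (ln M + 2)
        + subset_prob p E (\<lambda>H. nsets h' 2 \<subseteq> Proj n H) / M + Ent h'"
      unfolding Ent_def
    proof (rule posterior_sq_bound[OF M_ge h', where Q = "\<lambda>G. nsets h' 2 \<subseteq> G"])
      fix H assume "H \<subseteq> E" "h' \<in> H"
      then show "nsets h' 2 \<subseteq> Proj n H" by (auto simp: E_def Proj_eq_UN)
    qed
    \<comment> \<open>\<open>M\<close> is chosen so that \<open>q ^ C / M = p\<close>: spurious
      cliques cost only a constant times \<open>p\<close>.\<close>
    also have "subset_prob p E (\<lambda>H. nsets h' 2 \<subseteq> Proj n H) / M \<le> 2 ^ 2 ^ d * q ^ C / M"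
      unfolding E_def C_def
      by (intro divide_right_mono prob_clique_le) (use p q q_pos h' M_ge pq in \<open>auto simp: E_def\<close>)
    also have "\<dots> = 2 ^ 2 ^ d * p" using q_pos p by (simp add: M_def)
    finally show ?thesis by simp
  qed
  then have "(\<Sum>h'\<in>E. ?S * ln M / 2) \<le> (\<Sum>h'\<in>E. p * (ln M + 2) + 2 ^ 2 ^ d * p + Ent h')"
    by (rule sum_mono)
  then have "real N * (?S * ln M / 2)
      \<le> real N * (p * (ln M + 2) + 2 ^ 2 ^ d * p) + real N * p * (real d ^ d - ln M)"
    using Ent_le by (simp add: sum.distrib N_def)
  also have "\<dots> = real N * (p * (real d ^ d + 2 + 2 ^ 2 ^ d))" by (simp add: algebra_simps)
  finally have "?S * ln M / 2 \<le> p * (real d ^ d + 2 + 2 ^ 2 ^ d)"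
    using N_pos by (simp only: mult_le_cancel_left_pos of_nat_0_less_iff)
  then show ?thesis unfolding M_def C_def E_def by linarith
qed

text \<open>The graphs of positive probability are exactly the attained projections, and the
  conditional probability of \<open>A \<subseteq> H\<close> is
  \<open>joint A G / marg G\<close>.\<close>

lemma sum_cond_prob_sq_eq_posterior_sq:
  assumes p: "0 < p" "p < 1"
  shows "(\<Sum>G \<in> {G \<in> graphs_on n. \<P>(H in random_hypergraph d n p. Proj n H = G) > 0}.
            \<P>(H in random_hypergraph d n p. A \<subseteq> H \<bar> Proj n H = G)\<^sup>2
            * \<P>(H in random_hypergraph d n p. Proj n H = G))
    = observed_subset.posterior_sq p (nsets {1..n} d) (Proj n) A"
proof -
  define E where "E = nsets {1..n} d"
  interpret observed_subset p E "Proj n"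
    by unfold_locales (use p in \<open>auto simp: E_def finite_imp_finite_nsets\<close>)
  have prob: "\<P>(H in random_hypergraph d n p. Q H) = subset_prob p E Q" for Q
    using prob_random_hypergraph[of p d n Q] p by (simp add: E_def)
  have marg: "\<P>(H in random_hypergraph d n p. Proj n H = G) = marg G" for G
    using prob[of "\<lambda>H. Proj n H = G"] by (simp add: joint_def)
  have "{G \<in> graphs_on n. 0 < marg G} = Obs"
  proof (intro equalityI subsetI)
    fix G assume "G \<in> {G \<in> graphs_on n. 0 < marg G}"
    then have "marg G \<noteq> 0" by simp
    then show "G \<in> Obs"
      unfolding joint_def subset_prob_def by (auto elim!: sum.not_neutral_contains_not_neutral)
  next
    fix G assume "G \<in> Obs"
    then show "G \<in> {G \<in> graphs_on n. 0 < marg G}"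
      using marg_pos Proj_subset_nsets by (auto simp: graphs_on_def)
  qed
  moreover have "\<P>(H in random_hypergraph d n p. A \<subseteq> H \<bar> Proj n H = G)\<^sup>2 * marg G
      = (joint A G)\<^sup>2 / marg G" if "G \<in> Obs" for G
  proof -
    have "\<P>(H in random_hypergraph d n p. A \<subseteq> H \<bar> Proj n H = G) = joint A G / marg G"
      unfolding cond_prob_def prob joint_def by simp
    then show ?thesis using marg_pos[OF that] by (simp add: power2_eq_square)
  qed
  ultimately show ?thesis
    unfolding marg posterior_sq_def E_def[symmetric] by (simp cong: sum.cong)
qed

section \<open>Asymptotics in \<open>n\<close>\<close>

lemma filterlim_power_mult_powr_at_top:
  fixes u :: "nat \<Rightarrow> real"
  assumes "u \<longlonglongrightarrow> c" "0 < c" "0 < e"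
  shows "filterlim (\<lambda>n. u n ^ m * real n powr e) at_top sequentially"
proof (rule filterlim_tendsto_pos_mult_at_top)
  show "(\<lambda>n. u n ^ m) \<longlonglongrightarrow> c ^ m" by (intro tendsto_intros assms)
  show "0 < c ^ m" using assms by simp
  show "filterlim (\<lambda>n. real n powr e) at_top sequentially"
    using assms(3) by real_asymp
qed

theorem theorem21:
  fixes d k :: nat and c \<delta> :: real and p \<epsilon> :: "nat \<Rightarrow> real"
  assumes "d \<ge> 3" and "c > 0"
    and "(real d - 1) / (real d + 1) < \<delta>" and "\<delta> < 1" and "k \<ge> 1"
    and "\<epsilon> \<in> o(\<lambda>_. 1)"
    and "\<And>n. p n = (c + \<epsilon> n) * real n powr (- real d + 1 + \<delta>)"
  shows "(\<lambda>n. SUP hs \<in> {hs. length hs = k \<and> distinct hs \<and> set hs \<subseteq> nsets {1..n} d}.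
            \<Sum>G \<in> {G \<in> graphs_on n. \<P>(H in random_hypergraph d n (p n). Proj n H = G) > 0}.
              \<P>(H in random_hypergraph d n (p n). set hs \<subseteq> H \<bar> Proj n H = G)\<^sup>2
              * \<P>(H in random_hypergraph d n (p n). Proj n H = G))
         \<in> o(\<lambda>n. p n ^ k)"
proof -
  define u where "u n = c + \<epsilon> n" for n
  have "\<epsilon> \<longlonglongrightarrow> 0"
    using smalloD_tendsto[OF assms(6)] by simp
  then have u: "u \<longlonglongrightarrow> c" unfolding u_def by (auto intro!: tendsto_eq_intros)
  have p_eq: "p n = u n * real n powr (- real d + 1 + \<delta>)" for n
    using assms(7) by (simp add: u_def)
  define q where "q n = real n ^ (d - 2) * p n" for n
  have q_eq: "q n = u n * real n powr (\<delta> - 1)" if "0 < n" for n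
    using that assms(1) by (simp add: q_def p_eq powr_realpow[symmetric] of_nat_diff powr_add[symmetric])
  \<comment> \<open>The exponent of \<open>n\<close> in
    \<open>q n ^ (s choose 2) / (real n ^ (d - s) * p n)\<close>. The bound on
    \<open>\<delta>\<close> says \<open>(1 - \<delta>) * (d + 1) < 2\<close>, which makes it
    positive at \<open>s = d\<close> and hence for all smaller \<open>s \<ge> 3\<close>.\<close>
  define ex where "ex s = (real s - 2) * (1 - (1 - \<delta>) * (real s + 1) / 2)" for s :: nat
  have ex_pos: "0 < ex s" if "3 \<le> s" "s \<le> d" for s
  proof -
    have "(real d - 1) < \<delta> * (real d + 1)" using assms(3) by (simp add: divide_less_eq)
    then have "(1 - \<delta>) * (real d + 1) < 2" by (simp add: algebra_simps)
    moreover have "(1 - \<delta>) * (real s + 1) \<le> (1 - \<delta>) * (real d + 1)"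
      using that assms(4) by (intro mult_left_mono) auto
    ultimately show ?thesis using that unfolding ex_def by (intro mult_pos_pos) auto
  qed
  have ratio: "q n ^ (s choose 2) = u n ^ ((s choose 2) - 1) * real n powr ex s * (real n ^ (d - s) * p n)"
    if "0 < n" "2 \<le> s" "s \<le> d" for n s
  proof -
    have b: "real (s choose 2) = real s * (real s - 1) / 2"
      using that by (simp add: choose_two real_of_nat_div of_nat_diff)
    have "1 \<le> s choose 2" using that by (metis One_nat_def Suc_leI zero_less_binomial)
    then have "u n ^ (s choose 2) = u n ^ ((s choose 2) - 1) * u n"
      by (metis Suc_diff_le Suc_eq_plus1 diff_Suc_1 le_add_diff_inverse2 power_Suc2)
    moreover have "(real n powr (\<delta> - 1)) ^ (s choose 2)
        = real n powr ex s * (real n ^ (d - s) * real n powr (- real d + 1 + \<delta>))"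
      using that by (simp add: powr_realpow[symmetric] powr_powr powr_add[symmetric] of_nat_diff b)
        (simp add: ex_def field_simps)
    ultimately show ?thesis using that by (simp add: q_eq p_eq power_mult_distrib)
  qed
  define M where "M n = q n ^ (d choose 2) / p n" for n

  have u_pos: "\<forall>\<^sub>F n in sequentially. 0 < u n"
    using order_tendstoD(1)[OF u assms(2)] .
  have ev_pos: "\<forall>\<^sub>F n in sequentially. 0 < p n"
    using u_pos eventually_gt_at_top[of 0] by eventually_elim (simp add: p_eq)
  have "(\<lambda>n. u n * real n powr (\<delta> - 1)) \<longlonglongrightarrow> c * 0"
    by (rule tendsto_mult[OF u]) (use assms(4) in real_asymp)
  then have "\<forall>\<^sub>F n in sequentially. u n * real n powr (\<delta> - 1) < 1 / 2"
    by (rule order_tendstoD) simp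
  then have q_small: "\<forall>\<^sub>F n in sequentially. q n < 1 / 2"
    using eventually_gt_at_top[of 0] by eventually_elim (simp add: q_eq)
  \<comment> \<open>At \<open>s = 2\<close> the exponent is 0 and nothing diverges, but there the
    two sides are equal by the definition of \<open>q\<close>.\<close>
  have pq: "\<forall>\<^sub>F n in sequentially. \<forall>s\<in>{3..d}. real n ^ (d - s) * p n \<le> q n ^ (s choose 2)"
  proof (intro eventually_ball_finite ballI)
    fix s assume s: "s \<in> {3..d}"
    have "\<forall>\<^sub>F n in sequentially. 1 \<le> u n ^ ((s choose 2) - 1) * real n powr ex s"
      using filterlim_power_mult_powr_at_top[OF u assms(2) ex_pos] s
      by (auto simp: filterlim_at_top)
    then show "\<forall>\<^sub>F n in sequentially. real n ^ (d - s) * p n \<le> q n ^ (s choose 2)"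
      using ev_pos eventually_gt_at_top[of 0]
    proof eventually_elim
      case (elim n)
      then show ?case
        using ratio[of n s] s mult_right_mono[OF elim(1), of "real n ^ (d - s) * p n"] by simp
    qed
  qed simp
  have "filterlim (\<lambda>n. u n ^ ((d choose 2) - 1) * real n powr ex d) at_top sequentially"
    using assms(1) by (intro filterlim_power_mult_powr_at_top[OF u assms(2) ex_pos]) auto
  moreover have "\<forall>\<^sub>F n in sequentially. u n ^ ((d choose 2) - 1) * real n powr ex d = M n"
    using ev_pos eventually_gt_at_top[of 0]
    by eventually_elim (use ratio[of _ d] assms(1) in \<open>simp add: M_def\<close>)
  ultimately have "filterlim M at_top sequentially"
    by (rule filterlim_cong[THEN iffD1, OF refl refl, rotated])
  then have lnM: "filterlim (\<lambda>n. ln (M n)) at_top sequentially"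
    by (rule filterlim_compose[OF ln_at_top])

  define K where "K = real d ^ d + 2 + 2 ^ 2 ^ d"
  have K_pos: "0 < K" by (simp add: K_def add_nonneg_pos)
  show ?thesis
  proof (rule landau_o.smallI)
    fix \<eta> :: real assume \<eta>: "0 < \<eta>"
    \<comment> \<open>The factors come from \<open>p / (1 - p) \<le> 2 * p\<close> taken
      \<open>k - 1\<close> times, from \<open>posterior_sq_insert_le\<close>, and from the bound for
      a single hyperedge; \<open>ln (M n) \<ge> B\<close> brings their product below
      \<open>\<eta>\<close>.\<close>
    define B where "B = 2 ^ (k - 1) * (2 * real k * (2 * K)) / \<eta>"
    have "\<forall>\<^sub>F n in sequentially. max 1 B \<le> ln (M n)"
      using lnM unfolding filterlim_at_top by blast
    then show "\<forall>\<^sub>F n in sequentially.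
      norm (SUP hs \<in> {hs. length hs = k \<and> distinct hs \<and> set hs \<subseteq> nsets {1..n} d}.
            \<Sum>G \<in> {G \<in> graphs_on n. \<P>(H in random_hypergraph d n (p n). Proj n H = G) > 0}.
              \<P>(H in random_hypergraph d n (p n). set hs \<subseteq> H \<bar> Proj n H = G)\<^sup>2
              * \<P>(H in random_hypergraph d n (p n). Proj n H = G)) \<le> \<eta> * norm (p n ^ k)"
      using ev_pos q_small pq eventually_ge_at_top[of "d * k"]
    proof eventually_elim
      case (elim n)
      have "d \<le> d * k" using assms(5) by simp
      then have n: "d \<le> n" "0 < n" using elim(5) assms(1) by linarith+
      have "p n \<le> q n"
        using elim(2) n by (simp add: q_def mult_le_cancel_right1)
      then have p: "0 < p n" "p n \<le> 1 / 2" "p n < 1" using elim by auto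
      let ?E = "nsets {1..n} d"
      have finE: "finite ?E" by (simp add: finite_imp_finite_nsets)
      interpret observed_subset "p n" ?E "Proj n"
        by unfold_locales (use p finE in auto)
      let ?HS = "{hs. length hs = k \<and> distinct hs \<and> set hs \<subseteq> ?E}"
      have finHS: "finite ?HS"
        by (rule finite_subset[OF _ finite_lists_length_eq[OF finE, of k]]) auto
      have ne: "?HS \<noteq> {}"
      proof -
        \<comment> \<open>For \<open>n \<ge> d * k\<close> there are at least \<open>k\<close>
          hyperedges, so the supremum is over a nonempty set.\<close>
        have "real k \<le> real n / real d" using elim(5) assms(1) by (simp add: le_divide_eq mult.commute flip: of_nat_mult)
        also have "\<dots> \<le> (real n / real d) ^ d"
          using n assms(1) by (intro self_le_power) auto
        also have "\<dots> \<le> real (n choose d)" by (rule binomial_ge_n_over_k_pow_k[OF n(1)])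
        finally have "k \<le> card ?E" by simp
        then obtain T where "T \<subseteq> ?E" "card T = k" "finite T" by (rule obtain_subset_with_card_n)
        moreover then obtain hs where "set hs = T" "distinct hs" using finite_distinct_list by blast
        ultimately have "hs \<in> ?HS" by (auto simp: distinct_card[symmetric])
        then show ?thesis by blast
      qed
      define s where "s = 2 * p n * K / ln (M n)"
      have lnM1: "1 \<le> ln (M n)" "B \<le> ln (M n)" using elim(1) by auto
      have s: "posterior_sq {h} \<le> s" if h: "h \<in> ?E" for h
      proof -
        have "posterior_sq {h} * ln (q n ^ (d choose 2) / p n) \<le> 2 * p n * K"
          unfolding K_def
        proof (rule posterior_sq_Proj_bound[OF p(1,3) _ n(1) _ _ _ h])
          show "real n ^ (d - i) * p n \<le> q n ^ (i choose 2)" if "2 \<le> i" "i \<le> d" for i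
            using elim(4) that by (cases "i = 2") (auto simp: q_def)
        qed (use assms(1) elim in \<open>auto simp: q_def\<close>)
        then show ?thesis using lnM1 by (simp add: s_def M_def le_divide_eq)
      qed
      have bound: "posterior_sq (set hs) \<le> \<eta> * p n ^ k" if hs: "hs \<in> ?HS" for hs
      proof -
        obtain h t where ht: "hs = h # t" using hs assms(5) by (cases hs) auto
        \<comment> \<open>The first hyperedge is kept and the other \<open>k - 1\<close> are
          planted; planting adds their projection to the observed graph.\<close>
        have "posterior_sq (insert h (set t))
            \<le> (p n / (1 - p n)) ^ card (set t) * (2 * real (Suc (card (set t))) * s)"
          by (rule posterior_sq_insert_le[where \<psi> = "\<lambda>G. G \<union> Proj n (set t)"])
             (use hs ht s in \<open>auto simp: Proj_Un\<close>)
        also have "card (set t) = k - 1" using hs ht by (auto simp: distinct_card)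
        also have "(p n / (1 - p n)) ^ (k - 1) * (2 * real (Suc (k - 1)) * s)
            \<le> (2 * p n) ^ (k - 1) * (2 * real (Suc (k - 1)) * s)"
        proof (intro mult_right_mono power_mono)
          show "p n / (1 - p n) \<le> 2 * p n"
            using p mult_left_mono[of "p n" "1 / 2" "p n"] by (simp add: divide_le_eq algebra_simps)
        qed (use p K_pos lnM1 in \<open>auto simp: s_def\<close>)
        also have "\<dots> = p n ^ (k - 1) * p n * (2 ^ (k - 1) * (2 * real k * (2 * K)) / ln (M n))"
          using assms(5) by (simp add: s_def power_mult_distrib)
        also have "p n ^ (k - 1) * p n = p n ^ k"
          using assms(5) by (intro power_minus_mult) simp
        also have "2 ^ (k - 1) * (2 * real k * (2 * K)) / ln (M n) \<le> \<eta>"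
          using lnM1 \<eta> unfolding B_def by (simp add: divide_le_eq mult.commute)
        finally show ?thesis using p ht by (simp add: mult.commute)
      qed
      have nonneg: "0 \<le> posterior_sq A" for A
        unfolding posterior_sq_def by (intro sum_nonneg divide_nonneg_nonneg joint_nonneg) auto
      have "(SUP hs\<in>?HS. posterior_sq (set hs)) \<le> \<eta> * p n ^ k"
        by (rule cSUP_least[OF ne]) (rule bound)
      moreover have "0 \<le> (SUP hs\<in>?HS. posterior_sq (set hs))"
      proof -
        obtain hs where hs: "hs \<in> ?HS" using ne by blast
        have "posterior_sq (set hs) \<le> (SUP hs\<in>?HS. posterior_sq (set hs))"
          by (rule cSUP_upper[OF hs]) (use finHS in simp)
        then show ?thesis using nonneg[of "set hs"] by linarith
      qed
      ultimately show ?case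
        using p unfolding sum_cond_prob_sq_eq_posterior_sq[OF p(1,3)] by simp
    qed
  qed
qed

end
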